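(* Let $J$ be a finite nonempty set of jobs with positive rational processing times $p_j$ ($j\in J$), and let $\alpha<0$ and $\beta>0$ be rational cooling and heating rates. Consider one machine and the objective of minimizing the sum of completion times. Then there is an optimal normal schedule in which the jobs are completed in order from smallest to largest processing time. That is, there is a feasible normal schedule $S$ with $$\sum_{j\in J}C_j(S)=\inf\Big\{\sum_{j\in J}C_j(S') : S' \text{ a feasible normal schedule}\Big\}$$ such that for all $i,j\in J$ with $p_i<p_j$ we have $C_i(S)\le C_j(S)$.
   Context: Single machine setting. A schedule $S=(S_j:j\in J)$ for a finite set of jobs $J$ consists of a load function $S_j:\mathbb{R}_+\to\mathbb{R}_+$ for each job $j$ (where $\mathbb{R}_+=[0,\infty)$), assumed (locally) integrable; $S_j(t)$ is the fractional load of job $j$ at time $t$. The schedule is manageable if $\sum_{j\in J}S_j(t)\le 1$ for all $t\ge 0$. A schedule determines for each job $j$ a temperature $T_j:\mathbb{R}_+\to\mathbb{R}_+$, the (absolutely continuous) function with $T_j(0)=0$ and, for (almost every) $t$, $$\frac{\partial}{\partial t}T_j(t)=\begin{cases}\alpha(1-S_j(t))+\beta S_j(t) & \text{if } T_j(t)>0,\\ \max\{0,\alpha(1-S_j(t))+\beta S_j(t)\} & \text{if } T_j(t)=0.\end{cases}$$ The schedule is feasible if it is manageable and $T_j(t)\le 1$ for all $j\in J$, $t\ge 0$. The work on job $j$ up to time $t$ is $W_j(t)=\int_0^t S_j(s)\,ds$. The completion time of job $j$ is $C_j(S)=\min\{t\in\mathbb{R}_+: p_j\le W_j(t)\}$.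 Only schedules in which every job is completed (all $C_j(S)$ finite) are considered. A schedule is simple if there are $0=t_0<t_1<\dots<t_m$ such that $S_j(t)=S_j(t')$ for all $t,t'\in[t_{i-1},t_i)$, all $j\in J$ and all $i=1,\dots,m$; then its simplicity is said to be witnessed by $\{t_1,\dots,t_m\}$. A schedule is normal if it is simple with simplicity witnessed by $\{C_j(S):j\in J\}$, i.e. all loads are constant between successive completion times (starting from time $0$). *)

theory Defs
  imports "HOL-Analysis.Analysis"
begin

text \<open>
  Time is modelled by the nonnegative reals inside the type \<^typ>\<open>real\<close>: a schedule
  \<open>S :: 'j \<Rightarrow> real \<Rightarrow> real\<close> assigns to each job its load function, and only the values
  \<open>S j t\<close> with \<open>j \<in> J\<close> and \<open>t \<ge> 0\<close> are ever constrained or used.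
\<close>

definition schedule :: "'j set \<Rightarrow> ('j \<Rightarrow> real \<Rightarrow> real) \<Rightarrow> bool" where
  "schedule J S \<longleftrightarrow>
     (\<forall>j\<in>J. (\<forall>t\<ge>0. 0 \<le> S j t) \<and> (\<forall>b\<ge>0. S j absolutely_integrable_on {0..b}))"

definition manageable :: "'j set \<Rightarrow> ('j \<Rightarrow> real \<Rightarrow> real) \<Rightarrow> bool" where
  "manageable J S \<longleftrightarrow> (\<forall>t\<ge>0. (\<Sum>j\<in>J. S j t) \<le> 1)"

text \<open>
  Absolute continuity of a function on a compact interval. The finite set \<open>D\<close> contains the
  endpoint pairs of non-overlapping subintervals.
\<close>

definition abs_continuous_on :: "real \<Rightarrow> real \<Rightarrow> (real \<Rightarrow> real) \<Rightarrow> bool" where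
  "abs_continuous_on a b f \<longleftrightarrow>
     (\<forall>\<epsilon>>0. \<exists>\<delta>>0. \<forall>D :: (real \<times> real) set.
        finite D \<and> (\<forall>(x, y)\<in>D. a \<le> x \<and> x \<le> y \<and> y \<le> b) \<and>
        pairwise (\<lambda>(x, y) (u, v). {x<..<y} \<inter> {u<..<v} = {}) D \<and>
        (\<Sum>(x, y)\<in>D. y - x) < \<delta>
        \<longrightarrow> (\<Sum>(x, y)\<in>D. \<bar>f y - f x\<bar>) < \<epsilon>)"

text \<open>
  \<open>is_temperature \<alpha> \<beta> s T\<close> says that \<open>T\<close> is the temperature of a job with load function \<open>s\<close>,
  where \<open>\<alpha>\<close> is the cooling rate and \<open>\<beta>\<close> the heating rate. These conditions determine \<open>T\<close>
  uniquely on the nonnegative reals: for any two such functions, the squared difference has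
  nonpositive derivative almost everywhere. Hence \<open>\<exists>T\<close> in the definition of feasibility below
  refers to the temperature of the job.
\<close>

definition is_temperature ::
    "real \<Rightarrow> real \<Rightarrow> (real \<Rightarrow> real) \<Rightarrow> (real \<Rightarrow> real) \<Rightarrow> bool" where
  "is_temperature \<alpha> \<beta> s T \<longleftrightarrow>
     (\<forall>t\<ge>0. 0 \<le> T t) \<and>
     T 0 = 0 \<and>
     (\<forall>b\<ge>0. abs_continuous_on 0 b T) \<and>
     (AE t in lebesgue. 0 \<le> t \<longrightarrow>
        (T has_real_derivative
           (if T t > 0 then \<alpha> * (1 - s t) + \<beta> * s t
            else max 0 (\<alpha> * (1 - s t) + \<beta> * s t))) (at t within {0..}))"

definition feasible :: "real \<Rightarrow> real \<Rightarrow> 'j set \<Rightarrow> ('j \<Rightarrow> real \<Rightarrow> real) \<Rightarrow> bool" where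
  "feasible \<alpha> \<beta> J S \<longleftrightarrow>
     manageable J S \<and>
     (\<forall>j\<in>J. \<exists>T. is_temperature \<alpha> \<beta> (S j) T \<and> (\<forall>t\<ge>0. T t \<le> 1))"

definition work :: "('j \<Rightarrow> real \<Rightarrow> real) \<Rightarrow> 'j \<Rightarrow> real \<Rightarrow> real" where
  "work S j t = integral {0..t} (S j)"

definition all_completed :: "'j set \<Rightarrow> ('j \<Rightarrow> real) \<Rightarrow> ('j \<Rightarrow> real \<Rightarrow> real) \<Rightarrow> bool" where
  "all_completed J p S \<longleftrightarrow> (\<forall>j\<in>J. \<exists>t\<ge>0. p j \<le> work S j t)"

text \<open>
  For a job that is completed the minimum exists, since the work is continuous in time.
\<close>

definition completion_time :: "('j \<Rightarrow> real) \<Rightarrow> ('j \<Rightarrow> real \<Rightarrow> real) \<Rightarrow> 'j \<Rightarrow> real" where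
  "completion_time p S j = (LEAST t. 0 \<le> t \<and> p j \<le> work S j t)"

text \<open>
  The loads are not constrained after the last of the witnessing times.
\<close>

definition simplicity_witnessed_by ::
    "'j set \<Rightarrow> ('j \<Rightarrow> real \<Rightarrow> real) \<Rightarrow> real set \<Rightarrow> bool" where
  "simplicity_witnessed_by J S X \<longleftrightarrow>
     (\<exists>(m::nat) (t :: nat \<Rightarrow> real).
        t 0 = 0 \<and> strict_mono_on {0..m} t \<and> X = t ` {1..m} \<and>
        (\<forall>j\<in>J. \<forall>i\<in>{1..m}. \<forall>u\<in>{t (i - 1)..<t i}. \<forall>v\<in>{t (i - 1)..<t i}. S j u = S j v))"

definition normal_schedule :: "'j set \<Rightarrow> ('j \<Rightarrow> real) \<Rightarrow> ('j \<Rightarrow> real \<Rightarrow> real) \<Rightarrow> bool" where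
  "normal_schedule J p S \<longleftrightarrow> simplicity_witnessed_by J S (completion_time p S ` J)"

definition feasible_normal_schedules ::
    "real \<Rightarrow> real \<Rightarrow> 'j set \<Rightarrow> ('j \<Rightarrow> real) \<Rightarrow> ('j \<Rightarrow> real \<Rightarrow> real) set" where
  "feasible_normal_schedules \<alpha> \<beta> J p =
     {S. schedule J S \<and> feasible \<alpha> \<beta> J S \<and> all_completed J p S \<and> normal_schedule J p S}"

end

theory Submission
  imports Defs
begin

text \<open>
  The temperature is a reflected process: it equals the largest net heat gain over the intervals
  that end now. So it stays below \<open>1\<close> exactly if for all \<open>s \<le> t\<close> the work \<open>W\<close> on the job
  satisfies the thermal condition \<open>(\<beta> - \<alpha>) * (W t - W s) \<le> 1 - \<alpha> * (t - s)\<close>, which is linear in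
  the work. Sampling the work of a feasible schedule at time \<open>0\<close> and at the completion times gives
  a \<open>plan\<close>: finitely many numbers subject to weak linear inequalities (\<open>plan_of_schedule\<close>).
  Conversely, spreading the work of a plan evenly between consecutive grid times gives a feasible
  normal schedule that is at least as fast (\<open>tight_plan\<close>, \<open>schedule_of_tight_plan\<close>). Hence it is
  enough to find an optimal plan with the required order.

  Plans with bounded completion times are closed under limits, so an optimal one exists
  (\<open>optimal_plan_exists\<close>).

  For the order, let \<open>p i < p j\<close> although \<open>j\<close> is completed before \<open>i\<close>. Let \<open>x\<close> and \<open>y\<close> be the amounts
  of work on \<open>i\<close> and \<open>j\<close> in the grid intervals. The thermal condition bounds the sum over each block
  of consecutive intervals by a constant plus an additive function of the block. Such a bound is
  modular on blocks that meet, so the admissible vectors form a polymatroid, and \<open>x\<close>, having the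
  smaller total, can be augmented from \<open>y\<close>: there is an admissible \<open>u\<close> with \<open>x \<le> u \<le> x + y\<close> and the
  total of \<open>y\<close> (\<open>augmentation\<close>). Now \<open>j\<close> receives \<open>u\<close> and \<open>i\<close> receives \<open>x + y - u\<close>. The machine load
  is unchanged. The new work on \<open>i\<close> is at most \<open>y\<close> in every interval, hence thermally admissible and
  finished when \<open>j\<close> used to be finished; and \<open>u\<close> vanishes where \<open>x\<close> and \<open>y\<close> do, so \<open>j\<close> is finished
  when \<open>i\<close> used to be. The two completion times have been exchanged (\<open>plan_swap\<close>). Each such exchange
  increases the sum of the products \<open>p j * c j\<close>, so a maximiser of this sum among the permutations of
  an optimal plan is sorted (\<open>sorted_optimal_plan_exists\<close>).
\<close>

section \<open>Increments of absolutely continuous functions\<close>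

lemma open_cover_of_null_set:
  assumes "N \<in> null_sets lebesgue" and "0 < \<delta>"
  obtains U where "open U" "N \<subseteq> U" "U \<in> lmeasurable" "measure lebesgue U < \<delta>"
proof -
  obtain U where U: "open U" "N \<subseteq> U" "U - N \<in> lmeasurable" "emeasure lebesgue (U - N) < ennreal \<delta>"
    using sets_lebesgue_outer_open[of N \<delta>] assms by auto
  have "U \<in> sets lebesgue"
    using U(1) by auto
  then have em: "emeasure lebesgue U = emeasure lebesgue (U - N)"
    using emeasure_Diff_null_set[OF assms(1)] by simp
  then have "emeasure lebesgue U < \<infinity>"
    using U(4) less_trans by fastforce
  then have "U \<in> lmeasurable"
    using \<open>U \<in> sets lebesgue\<close> by (simp add: fmeasurable_def)
  moreover from this have "measure lebesgue U < \<delta>"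
    using U(4) em by (metis emeasure_eq_measure2 ennreal_less_iff measure_nonneg)
  ultimately show thesis
    using that U by blast
qed

text \<open>
  This follows from a Henstock argument. In a sufficiently fine tagged division of \<open>{a..b}\<close>, a cell tagged
  outside \<open>N\<close> is so short that the derivative at its tag controls the increment of \<open>f\<close>. All
  cells tagged in \<open>N\<close> lie in one open set of small measure, so by absolute continuity the increments
  of \<open>f\<close> over them are negligible altogether.
\<close>

lemma integral_le_increment_if_abs_continuous:
  fixes f g :: "real \<Rightarrow> real"
  assumes ab: "a \<le> b" and AC: "abs_continuous_on a b f" and N: "N \<in> null_sets lebesgue"
    and der: "\<And>t. t \<in> {a..b} - N \<Longrightarrow>
        \<exists>d. (f has_real_derivative d) (at t within {a..b}) \<and> g t \<le> d"
    and g: "g integrable_on {a..b}"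
  shows "integral {a..b} g \<le> f b - f a"
proof (rule field_le_epsilon)
  fix e :: real
  assume "0 < e"
  define \<eta> where "\<eta> = e / (b - a + 2)"
  have \<eta>: "0 < \<eta>" "\<eta> * (b - a) + 2 * \<eta> = e"
    proof -
    show "0 < \<eta>"
      using \<open>0 < e\<close> ab by (auto simp: \<eta>_def)
    have "\<eta> * (b - a + 2) = e"
      using ab by (simp add: \<eta>_def)
    then show "\<eta> * (b - a) + 2 * \<eta> = e"
      by (simp add: algebra_simps)
  qed
  obtain \<delta> where "0 < \<delta>" and \<delta>: "\<And>D :: (real \<times> real) set.
      \<lbrakk>finite D; \<forall>(x, y)\<in>D. a \<le> x \<and> x \<le> y \<and> y \<le> b;
       pairwise (\<lambda>(x, y) (u, v). {x<..<y} \<inter> {u<..<v} = {}) D; (\<Sum>(x, y)\<in>D. y - x) < \<delta>\<rbrakk>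
      \<Longrightarrow> (\<Sum>(x, y)\<in>D. \<bar>f y - f x\<bar>) < \<eta>"
    using AC \<eta>(1) unfolding abs_continuous_on_def by meson
  obtain U where U: "open U" "N \<subseteq> U" "U \<in> lmeasurable" "measure lebesgue U < \<delta>"
    using open_cover_of_null_set[OF N \<open>0 < \<delta>\<close>] by blast
  define h where "h t = (if t \<in> N then 0 else g t)" for t
  have "(h has_integral integral {a..b} g) {a..b}"
    using N g by (intro has_integral_spike[of N _ h g]) (auto simp: h_def negligible_iff_null_sets)
  then obtain \<gamma> where \<gamma>: "gauge \<gamma>" "\<And>p. \<lbrakk>p tagged_division_of {a..b}; \<gamma> fine p\<rbrakk> \<Longrightarrow>
      norm ((\<Sum>(x, K)\<in>p. measure lborel K *\<^sub>R h x) - integral {a..b} g) < \<eta>"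
    using \<eta>(1) unfolding has_integral_real by meson
  have "\<exists>r>0. x \<in> {a..b} - N \<longrightarrow> (\<forall>u\<in>{a..b}. \<forall>v\<in>{a..b}. u \<le> x \<and> x \<le> v \<and> \<bar>u - x\<bar> < r \<and> \<bar>v - x\<bar> < r \<longrightarrow>
      g x * (v - u) - \<eta> * (v - u) \<le> f v - f u)" for x
  proof (cases "x \<in> {a..b} - N")
    case True
    then obtain d where d: "(f has_real_derivative d) (at x within {a..b})" "g x \<le> d"
      using der by blast
    obtain r where r: "r > 0" "\<And>y. \<lbrakk>y \<in> {a..b}; \<bar>y - x\<bar> < r\<rbrakk> \<Longrightarrow> \<bar>f y - f x - d * (y - x)\<bar> \<le> \<eta> * \<bar>y - x\<bar>"
      using d(1) \<eta>(1) unfolding has_field_derivative_def has_derivative_within_alt by auto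
    have "g x * (v - u) - \<eta> * (v - u) \<le> f v - f u"
      if "u \<in> {a..b}" "v \<in> {a..b}" "u \<le> x" "x \<le> v" "\<bar>u - x\<bar> < r" "\<bar>v - x\<bar> < r" for u v
    proof -
      have "f v - f x \<ge> d * (v - x) - \<eta> * (v - x)" "f x - f u \<ge> d * (x - u) - \<eta> * (x - u)"
        using r(2)[of v] r(2)[of u] that by (auto simp: algebra_simps)
      then have "f v - f u \<ge> d * (v - u) - \<eta> * (v - u)"
        by (simp add: algebra_simps)
      moreover have "g x * (v - u) \<le> d * (v - u)"
        using d(2) that by (intro mult_right_mono) auto
      ultimately show ?thesis by linarith
    qed
    then show ?thesis using r(1) by blast
  qed (use zero_less_one in blast)
  then obtain r where r: "\<And>x. r x > (0::real)" "\<And>x u v. \<lbrakk>x \<in> {a..b} - N; u \<in> {a..b}; v \<in> {a..b};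
      u \<le> x; x \<le> v; \<bar>u - x\<bar> < r x; \<bar>v - x\<bar> < r x\<rbrakk> \<Longrightarrow> g x * (v - u) - \<eta> * (v - u) \<le> f v - f u"
    by metis
  \<comment> \<open>Cells tagged in \<open>N\<close> lie in the small open set \<open>U\<close>, the others are short enough for the derivative.\<close>
  define \<gamma>' where "\<gamma>' x = \<gamma> x \<inter> (if x \<in> N then U else ball x (r x))" for x
  have "gauge (\<lambda>x. if x \<in> N then U else ball x (r x))"
    using U(1,2) r(1) by (auto simp: gauge_def)
  then have "gauge \<gamma>'"
    unfolding \<gamma>'_def using \<gamma>(1) by (rule gauge_Int[rotated])
  then obtain p where p: "p tagged_division_of {a..b}" "\<gamma>' fine p"
    by (rule fine_division_exists_real)
  have fin: "finite p"
    using p(1) by (rule tagged_division_of_finite)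
  have cell: "\<exists>u v. K = {u..v} \<and> u \<le> v \<and> a \<le> u \<and> v \<le> b \<and> u \<le> x \<and> x \<le> v" if "(x, K) \<in> p" for x K
    using tagged_division_ofD(2,3,4)[OF p(1) that] by auto
  have sub: "K \<subseteq> \<gamma>' x" if "(x, K) \<in> p" for x K
    using p(2) that by (auto simp: fine_def)
  define q where "q = {z \<in> p. fst z \<in> N}"
  have qp: "q \<subseteq> p" "finite q"
    using fin by (auto simp: q_def)
  define \<phi> :: "real \<times> real set \<Rightarrow> real \<times> real" where "\<phi> = (\<lambda>(x, K). (Inf K, Sup K))"
  have disj: "{fst (\<phi> z)<..<snd (\<phi> z)} \<inter> {fst (\<phi> z')<..<snd (\<phi> z')} = {}"
    if "z \<in> p" "z' \<in> p" "z \<noteq> z'" for z z'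
  proof -
    obtain x K x' K' where z: "z = (x, K)" "z' = (x', K')"
      by (cases z, cases z')
    have "interior K \<inter> interior K' = {}"
      using tagged_division_ofD(5)[OF p(1), of x K x' K'] that z by simp
    then show ?thesis
      using cell[of x K] cell[of x' K'] that z by (auto simp: \<phi>_def)
  qed
  have pw: "pairwise (\<lambda>(x, y) (u, v). {x<..<y} \<inter> {u<..<v} = {}) (\<phi> ` q)"
  proof (rule pairwiseI)
    fix w w'
    assume "w \<in> \<phi> ` q" "w' \<in> \<phi> ` q" "w \<noteq> w'"
    then obtain z z' where "z \<in> q" "z' \<in> q" "w = \<phi> z" "w' = \<phi> z'"
      by blast
    then have "z \<in> p" "z' \<in> p" "z \<noteq> z'" "w = \<phi> z" "w' = \<phi> z'"
      using qp \<open>w \<noteq> w'\<close> by auto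
    then show "(case w of (x, y) \<Rightarrow> \<lambda>(u, v). {x<..<y} \<inter> {u<..<v} = {}) w'"
      using disj[of z z'] by (auto simp: case_prod_beta)
  qed
  have reindex: "(\<Sum>(x, y)\<in>\<phi> ` q. F y x) = (\<Sum>(x, K)\<in>q. F (Sup K) (Inf K))"
    if F: "\<And>x. F x x = (0::real)" for F
  proof -
    have "(\<Sum>w\<in>\<phi> ` q. F (snd w) (fst w)) = (\<Sum>z\<in>q. F (snd (\<phi> z)) (fst (\<phi> z)))"
    proof (subst sum.reindex_nontrivial[OF qp(2)])
      fix z z'
      assume z: "z \<in> q" "z' \<in> q" "z \<noteq> z'" "\<phi> z = \<phi> z'"
      then have "{fst (\<phi> z)<..<snd (\<phi> z)} = {}"
        using disj[of z z'] qp by auto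
      moreover have "fst (\<phi> z) \<le> snd (\<phi> z)"
        using cell[of "fst z" "snd z"] z qp by (force simp: \<phi>_def case_prod_beta)
      ultimately show "F (snd (\<phi> z)) (fst (\<phi> z)) = 0"
        using F by simp
    qed simp
    then show ?thesis
      by (simp add: case_prod_beta \<phi>_def)
  qed
  have bnd: "\<forall>(x, y)\<in>\<phi> ` q. a \<le> x \<and> x \<le> y \<and> y \<le> b"
    using cell qp by (fastforce simp: \<phi>_def)
  have "(\<Sum>(x, y)\<in>\<phi> ` q. y - x) < \<delta>"
  proof -
    have meas: "measure lebesgue {x<..<y} = y - x" if "x \<le> y" for x y :: real
      using that by simp
    have "(\<Sum>(x, y)\<in>\<phi> ` q. y - x) = (\<Sum>w\<in>\<phi> ` q. measure lebesgue {fst w<..<snd w})"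
      using bnd by (intro sum.cong) auto
    also have "\<dots> = measure lebesgue (\<Union>w\<in>\<phi> ` q. {fst w<..<snd w})"
      using qp pw by (intro measure_UNION'[symmetric]) (auto simp: pairwise_def disjnt_def case_prod_beta)
    also have "\<dots> \<le> measure lebesgue U"
    proof (rule measure_mono_fmeasurable)
      show "(\<Union>w\<in>\<phi> ` q. {fst w<..<snd w}) \<subseteq> U"
      proof
        fix t
        assume "t \<in> (\<Union>w\<in>\<phi> ` q. {fst w<..<snd w})"
        then obtain x K where "(x, K) \<in> q" "t \<in> {fst (\<phi> (x, K))<..<snd (\<phi> (x, K))}"
          by auto
        then show "t \<in> U"
          using sub[of x K] cell[of x K] by (auto simp: q_def \<phi>_def \<gamma>'_def)
      qed
    qed (use U qp in auto)
    finally show ?thesis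
      using U(4) by simp
  qed
  then have small: "(\<Sum>(x, K)\<in>q. \<bar>f (Sup K) - f (Inf K)\<bar>) < \<eta>"
    using \<delta>[OF _ bnd pw] qp reindex[of "\<lambda>y x. \<bar>f y - f x\<bar>"] by simp
  have local_bound: "h x * (Sup K - Inf K) - \<eta> * (Sup K - Inf K)
      - (if (x, K) \<in> q then \<bar>f (Sup K) - f (Inf K)\<bar> else 0) \<le> f (Sup K) - f (Inf K)" if xK: "(x, K) \<in> p" for x K
  proof -
    obtain u v where K: "K = {u..v}" "u \<le> v" "a \<le> u" "v \<le> b" "u \<le> x" "x \<le> v"
      using cell[OF xK] by blast
    show ?thesis
    proof (cases "x \<in> N")
      case True
      have "0 \<le> \<eta> * (v - u)"
        using \<eta>(1) K by simp
      then show ?thesis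
        using True K xK by (simp add: h_def q_def)
    next
      case False
      then have "K \<subseteq> ball x (r x)"
        using sub[OF xK] by (simp add: \<gamma>'_def)
    moreover have "u \<in> K" "v \<in> K"
        using K by auto
      ultimately have "u \<in> ball x (r x)" "v \<in> ball x (r x)"
        by auto
      then show ?thesis
        using r(2)[of x u v] False K by (simp add: h_def q_def dist_real_def abs_minus_commute)
    qed
  qed
  have "(\<Sum>(x, K)\<in>p. h x * (Sup K - Inf K)) - \<eta> * (\<Sum>(x, K)\<in>p. Sup K - Inf K)
      - (\<Sum>(x, K)\<in>q. \<bar>f (Sup K) - f (Inf K)\<bar>) \<le> (\<Sum>(x, K)\<in>p. f (Sup K) - f (Inf K))"
  proof -
    have "(\<Sum>z\<in>q. \<bar>f (Sup (snd z)) - f (Inf (snd z))\<bar>)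
        = (\<Sum>z\<in>p. if z \<in> q then \<bar>f (Sup (snd z)) - f (Inf (snd z))\<bar> else 0)"
      using qp fin by (simp add: sum.If_cases Int_absorb1 flip: sum.inter_restrict)
    moreover have "(\<Sum>z\<in>p. h (fst z) * (Sup (snd z) - Inf (snd z)) - \<eta> * (Sup (snd z) - Inf (snd z))
        - (if z \<in> q then \<bar>f (Sup (snd z)) - f (Inf (snd z))\<bar> else 0))
        \<le> (\<Sum>z\<in>p. f (Sup (snd z)) - f (Inf (snd z)))"
      using local_bound[of "fst z" "snd z" for z] by (intro sum_mono) simp
    ultimately show ?thesis
      unfolding sum_distrib_left case_prod_beta sum_subtractf by simp
  qed
  moreover have "(\<Sum>(x, K)\<in>p. Sup K - Inf K) = b - a"
    using additive_tagged_division_1[OF ab p(1), of "\<lambda>x. x"] by simp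
  moreover have "(\<Sum>(x, K)\<in>p. f (Sup K) - f (Inf K)) = f b - f a"
    using additive_tagged_division_1[OF ab p(1)] .
  moreover have "(\<Sum>(x, K)\<in>p. h x * (Sup K - Inf K)) > integral {a..b} g - \<eta>"
  proof -
    have "(\<Sum>(x, K)\<in>p. h x * (Sup K - Inf K)) = (\<Sum>(x, K)\<in>p. measure lborel K *\<^sub>R h x)"
      using cell by (intro sum.cong) fastforce+
    moreover have "\<gamma> fine p"
      using p(2) by (auto simp: fine_def \<gamma>'_def)
    ultimately show ?thesis
      using \<gamma>(2)[OF p(1)] by (simp add: abs_less_iff)
  qed
  ultimately show "integral {a..b} g \<le> f b - f a + e"
    using small \<eta>(2) by simp
qed

section \<open>Plans and the thermal condition\<close>

definition grid :: "'j set \<Rightarrow> ('j \<Rightarrow> real) \<Rightarrow> real set" where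
  "grid J c = insert 0 (c ` J)"

text \<open>
  A plan records the work on each job at time \<open>0\<close> and at the completion times. The inequalities are
  required for all pairs of grid points and not only for
  consecutive ones, so that they survive when grid points are dropped. The time \<open>c j\<close> only bounds
  the completion of \<open>j\<close> from above, since \<open>W j\<close> may reach \<open>p j\<close> at an earlier grid point; this is
  what makes the notion closed under limits and exchanges.
\<close>

definition plan ::
    "real \<Rightarrow> real \<Rightarrow> 'j set \<Rightarrow> ('j \<Rightarrow> real) \<Rightarrow> ('j \<Rightarrow> real) \<Rightarrow> ('j \<Rightarrow> real \<Rightarrow> real) \<Rightarrow> bool" where
  "plan \<alpha> \<beta> J p c W \<longleftrightarrow>
     (\<forall>j\<in>J. 0 \<le> c j \<and> W j 0 = 0 \<and> (\<forall>g\<in>grid J c. c j \<le> g \<longrightarrow> W j g = p j)) \<and>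
     (\<forall>s\<in>grid J c. \<forall>t\<in>grid J c. s \<le> t \<longrightarrow>
        (\<forall>j\<in>J. W j s \<le> W j t \<and> (\<beta> - \<alpha>) * (W j t - W j s) \<le> 1 - \<alpha> * (t - s)) \<and>
        (\<Sum>j\<in>J. W j t - W j s) \<le> t - s)"

lemma abs_continuous_on_subinterval:
  assumes "abs_continuous_on a b f" "a \<le> c" "d \<le> b"
  shows "abs_continuous_on c d f"
  unfolding abs_continuous_on_def
proof (intro allI impI)
  fix \<epsilon> :: real
  assume "0 < \<epsilon>"
  then obtain \<delta> where "0 < \<delta>" and \<delta>: "\<And>D :: (real \<times> real) set.
      finite D \<and> (\<forall>(x, y)\<in>D. a \<le> x \<and> x \<le> y \<and> y \<le> b) \<and>
      pairwise (\<lambda>(x, y) (u, v). {x<..<y} \<inter> {u<..<v} = {}) D \<and> (\<Sum>(x, y)\<in>D. y - x) < \<delta>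
      \<Longrightarrow> (\<Sum>(x, y)\<in>D. \<bar>f y - f x\<bar>) < \<epsilon>"
    using assms(1) unfolding abs_continuous_on_def by meson
  show "\<exists>\<delta>>0. \<forall>D :: (real \<times> real) set.
      finite D \<and> (\<forall>(x, y)\<in>D. c \<le> x \<and> x \<le> y \<and> y \<le> d) \<and>
      pairwise (\<lambda>(x, y) (u, v). {x<..<y} \<inter> {u<..<v} = {}) D \<and> (\<Sum>(x, y)\<in>D. y - x) < \<delta>
      \<longrightarrow> (\<Sum>(x, y)\<in>D. \<bar>f y - f x\<bar>) < \<epsilon>"
  proof (intro exI conjI allI impI)
    fix D :: "(real \<times> real) set"
    assume D: "finite D \<and> (\<forall>(x, y)\<in>D. c \<le> x \<and> x \<le> y \<and> y \<le> d) \<and>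
      pairwise (\<lambda>(x, y) (u, v). {x<..<y} \<inter> {u<..<v} = {}) D \<and> (\<Sum>(x, y)\<in>D. y - x) < \<delta>"
    then have "\<forall>(x, y)\<in>D. a \<le> x \<and> x \<le> y \<and> y \<le> b"
      using assms(2,3) by fastforce
    with D show "(\<Sum>(x, y)\<in>D. \<bar>f y - f x\<bar>) < \<epsilon>"
      by (intro \<delta>) simp
  qed (rule \<open>0 < \<delta>\<close>)
qed

lemma load_integrable:
  assumes "schedule J S" "j \<in> J" "0 \<le> s"
  shows "S j integrable_on {s..t}"
proof (cases "s \<le> t")
  case True
  then have "S j integrable_on {0..t}"
    using assms by (auto simp: schedule_def intro!: set_lebesgue_integral_eq_integral(1))
  then show ?thesis
    by (rule integrable_subinterval_real) (use assms(3) in auto)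
qed auto

lemma work_diff:
  assumes "schedule J S" "j \<in> J" "0 \<le> s" "s \<le> t"
  shows "work S j t - work S j s = integral {s..t} (S j)"
  using Henstock_Kurzweil_Integration.integral_combine[OF assms(3,4) load_integrable[OF assms(1,2)]]
  by (simp add: work_def)

lemma work_mono:
  assumes "schedule J S" "j \<in> J" "0 \<le> s" "s \<le> t"
  shows "work S j s \<le> work S j t"
proof -
  have "0 \<le> integral {s..t} (S j)"
    using assms by (intro integral_nonneg load_integrable) (auto simp: schedule_def)
  then show ?thesis using work_diff[OF assms] by simp
qed

lemma total_work_bound:
  assumes "schedule J S" "manageable J S" "finite J" "0 \<le> s" "s \<le> t"
  shows "(\<Sum>j\<in>J. work S j t - work S j s) \<le> t - s"
proof -
  have "(\<Sum>j\<in>J. work S j t - work S j s) = (\<Sum>j\<in>J. integral {s..t} (S j))"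
    using work_diff[OF assms(1)] assms by simp
  also have "\<dots> = integral {s..t} (\<lambda>x. \<Sum>j\<in>J. S j x)"
    using assms by (intro integral_sum[symmetric] load_integrable) auto
  also have "\<dots> \<le> integral {s..t} (\<lambda>x. 1 :: real)"
  proof (rule integral_le)
    show "(\<lambda>x. \<Sum>j\<in>J. S j x) integrable_on {s..t}"
      using assms load_integrable by (intro integrable_sum) auto
  qed (use assms in \<open>auto simp: manageable_def\<close>)
  finally show ?thesis using assms by simp
qed

text \<open>
  The temperature grows at least as fast as without the reflection at \<open>0\<close>, starts at a nonnegative
  value and ends at most at \<open>1\<close>.
\<close>

lemma thermal_work_bound:
  assumes S: "schedule J S" "feasible \<alpha> \<beta> J S" and j: "j \<in> J" and st: "0 \<le> s" "s \<le> t"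
  shows "(\<beta> - \<alpha>) * (work S j t - work S j s) \<le> 1 - \<alpha> * (t - s)"
proof -
  obtain T where T: "is_temperature \<alpha> \<beta> (S j) T" "\<And>t. 0 \<le> t \<Longrightarrow> T t \<le> 1"
    using S(2) j unfolding feasible_def by blast
  let ?g = "\<lambda>x. \<alpha> * (1 - S j x) + \<beta> * S j x"
  define P where "P x \<longleftrightarrow> (0 \<le> x \<longrightarrow> (T has_real_derivative (if T x > 0 then ?g x else max 0 (?g x)))
     (at x within {0..}))" for x
  have "AE x in lebesgue. P x"
    using T(1) by (simp add: is_temperature_def P_def)
  then obtain N where N: "N \<in> null_sets lebesgue" "{x \<in> space lebesgue. \<not> P x} \<subseteq> N"
    unfolding eventually_ae_filter by blast
  have int: "S j integrable_on {s..t}"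
    using load_integrable[OF S(1) j st(1)] .
  have g: "?g = (\<lambda>x. \<alpha> + (\<beta> - \<alpha>) * S j x)"
    by (auto simp: algebra_simps)
  have g_int: "((\<lambda>x. \<alpha> + (\<beta> - \<alpha>) * S j x) has_integral \<alpha> * (t - s) + (\<beta> - \<alpha>) * integral {s..t} (S j)) {s..t}"
    using has_integral_add[OF has_integral_const_real[of \<alpha> s t] has_integral_mult_right[OF integrable_integral[OF int], of "\<beta> - \<alpha>"]] st
    by (simp add: mult.commute)
  have "integral {s..t} ?g \<le> T t - T s"
  proof (rule integral_le_increment_if_abs_continuous[OF st(2) _ N(1)])
    show "abs_continuous_on s t T"
      using T(1) st by (intro abs_continuous_on_subinterval[of 0 t T s t]) (auto simp: is_temperature_def)
    show "?g integrable_on {s..t}"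
      unfolding g using g_int by blast
    fix x
    assume x: "x \<in> {s..t} - N"
    then have "P x" using N(2) by auto
    then have "(T has_real_derivative (if T x > 0 then ?g x else max 0 (?g x))) (at x within {s..t})"
      using x st by (auto simp: P_def intro: DERIV_subset)
    then show "\<exists>d. (T has_real_derivative d) (at x within {s..t}) \<and> ?g x \<le> d"
      by (intro exI conjI) auto
  qed
  moreover have "integral {s..t} ?g = \<alpha> * (t - s) + (\<beta> - \<alpha>) * (work S j t - work S j s)"
    unfolding g work_diff[OF S(1) j st] using g_int by (rule integral_unique)
  moreover have "T t \<le> 1" "0 \<le> T s"
    using T st by (auto simp: is_temperature_def)
  ultimately show ?thesis by linarith
qed

lemma completion_time_attained:
  assumes S: "schedule J S" "all_completed J p S" and j: "j \<in> J"
  shows "0 \<le> completion_time p S j" "p j \<le> work S j (completion_time p S j)"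
proof -
  obtain t where t: "0 \<le> t" "p j \<le> work S j t"
    using S(2) j unfolding all_completed_def by blast
  let ?A = "{0..t} \<inter> work S j -` {p j..}"
  have "continuous_on {0..t} (work S j)"
    using indefinite_integral_continuous_1[OF load_integrable[OF S(1) j order_refl]]
    by (simp add: work_def)
  then have "closed ?A"
    by (intro continuous_closed_preimage) auto
  then have "compact ?A"
    by (metis bounded_Int bounded_closed_interval compact_eq_bounded_closed)
  moreover have "?A \<noteq> {}"
    using t by auto
  ultimately obtain c where c: "c \<in> ?A" "\<And>s. s \<in> ?A \<Longrightarrow> c \<le> s"
    using compact_attains_inf[of ?A] by blast
  have "completion_time p S j = c"
    unfolding completion_time_def
  proof (rule Least_equality)
    fix s
    assume "0 \<le> s \<and> p j \<le> work S j s"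
    then show "c \<le> s"
      using c(1) c(2)[of s] by fastforce
  qed (use c in auto)
  then show "0 \<le> completion_time p S j" "p j \<le> work S j (completion_time p S j)"
    using c by auto
qed

text \<open>
  A schedule may continue to process a completed job, whereas the work in a plan stops at \<open>p j\<close>. Capping the work
  does not enlarge its increments, so all bounds are preserved.
\<close>

lemma plan_of_schedule:
  assumes fin: "finite J" and rates: "\<alpha> < \<beta>" and p: "\<And>j. j \<in> J \<Longrightarrow> 0 < p j"
    and S: "schedule J S" "feasible \<alpha> \<beta> J S" "all_completed J p S"
  shows "plan \<alpha> \<beta> J p (completion_time p S) (\<lambda>j t. min (p j) (work S j t))"
  unfolding plan_def
proof (intro conjI ballI impI)
  note C = completion_time_attained[OF S(1,3)]
  fix j
  assume j: "j \<in> J"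
  show "0 \<le> completion_time p S j" using C(1)[OF j] .
  show "min (p j) (work S j 0) = 0"
    using p[OF j] by (simp add: work_def)
  fix g
  assume "completion_time p S j \<le> g"
  then have "p j \<le> work S j g"
    using C[OF j] work_mono[OF S(1) j C(1)[OF j]] by fastforce
  then show "min (p j) (work S j g) = p j" by simp
next
  have grid: "0 \<le> g" if "g \<in> grid J (completion_time p S)" for g
    using that completion_time_attained[OF S(1,3)] by (auto simp: grid_def)
  fix s t
  assume st: "s \<in> grid J (completion_time p S)" "t \<in> grid J (completion_time p S)" "s \<le> t"
  have inc: "min (p j) (work S j t) - min (p j) (work S j s) \<le> work S j t - work S j s" if "j \<in> J" for j
    using work_mono[OF S(1) that grid[OF st(1)] st(3)] by (simp add: min_def)
  show "(\<Sum>j\<in>J. min (p j) (work S j t) - min (p j) (work S j s)) \<le> t - s"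
  proof -
    have "manageable J S"
      using S(2) by (simp add: feasible_def)
    then show ?thesis
      using sum_mono[OF inc, of J "\<lambda>j. j"] total_work_bound[OF S(1) _ fin grid[OF st(1)] st(3)] by simp
  qed
  fix j
  assume j: "j \<in> J"
  show "min (p j) (work S j s) \<le> min (p j) (work S j t)"
    using work_mono[OF S(1) j grid[OF st(1)] st(3)] by simp
  have "(\<beta> - \<alpha>) * (min (p j) (work S j t) - min (p j) (work S j s)) \<le> (\<beta> - \<alpha>) * (work S j t - work S j s)"
    using inc[OF j] rates by (intro mult_left_mono) auto
  then show "(\<beta> - \<alpha>) * (min (p j) (work S j t) - min (p j) (work S j s)) \<le> 1 - \<alpha> * (t - s)"
    using thermal_work_bound[OF S(1,2) j grid[OF st(1)] st(3)] by linarith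
qed

section \<open>Polymatroid augmentation\<close>

lemma sum_update:
  fixes u :: "nat \<Rightarrow> real"
  shows "sum (u(K := u K + e)) {i..<k} = sum u {i..<k} + (if i \<le> K \<and> K < k then e else 0)"
proof (cases "i \<le> K \<and> K < k")
  case True
  then have "K \<in> {i..<k}" by simp
  then show ?thesis
    using True by (simp add: sum.remove[of "{i..<k}" K])
next
  case False
  then have "sum (u(K := u K + e)) {i..<k} = sum u {i..<k}"
    by (intro sum.cong) auto
  then show ?thesis using False by auto
qed

text \<open>
  The vector \<open>x\<close> is raised at one index after the other, each time by the smallest slack of a block
  that contains the index, or until \<open>x + y\<close> is reached. A block that has become tight remains tight,
  since afterwards no index in it can be raised. An index \<open>l\<close> that is not contained in a tight block
  was raised to \<open>x l + y l\<close>, which is at least \<open>y l\<close>.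
\<close>

lemma saturate:
  fixes x y h :: "nat \<Rightarrow> real"
  assumes y: "\<And>k. 0 \<le> y k" and x: "\<And>k. 0 \<le> x k"
    and cx: "\<And>i k. \<lbrakk>i \<le> k; k \<le> m\<rbrakk> \<Longrightarrow> sum x {i..<k} \<le> A + h k - h i"
    and K: "K \<le> m"
  shows "\<exists>u. (\<forall>k. x k \<le> u k \<and> u k \<le> x k + y k) \<and>
     (\<forall>i k. i \<le> k \<longrightarrow> k \<le> m \<longrightarrow> sum u {i..<k} \<le> A + h k - h i) \<and>
     (\<forall>l<K. y l \<le> u l \<or> (\<exists>i k. i \<le> l \<and> l < k \<and> k \<le> m \<and> sum u {i..<k} = A + h k - h i))"
  using K
proof (induction K)
  case 0
  then show ?case
    using cx y by (intro exI[of _ x]) auto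
next
  case (Suc K)
  then obtain u where u: "\<And>k. x k \<le> u k \<and> u k \<le> x k + y k"
      "\<And>i k. \<lbrakk>i \<le> k; k \<le> m\<rbrakk> \<Longrightarrow> sum u {i..<k} \<le> A + h k - h i"
      "\<And>l. l < K \<Longrightarrow> y l \<le> u l \<or> (\<exists>i k. i \<le> l \<and> l < k \<and> k \<le> m \<and> sum u {i..<k} = A + h k - h i)"
    by (metis Suc_leD)
  define slack where "slack = (\<lambda>(i, k). A + h k - h i - sum u {i..<k})"
  define B where "B = {..K} \<times> {K<..m}"
  define \<delta> where "\<delta> = Min (slack ` B)"
  define e where "e = min \<delta> (x K + y K - u K)"
  have B: "finite (slack ` B)" "slack ` B \<noteq> {}"
    using Suc.prems by (auto simp: B_def)
  have \<delta>_le: "\<delta> \<le> slack (i, k)" if "i \<le> K" "K < k" "k \<le> m" for i k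
    unfolding \<delta>_def using B that by (intro Min_le) (auto simp: B_def)
  have \<delta>_in: "\<exists>i k. i \<le> K \<and> K < k \<and> k \<le> m \<and> slack (i, k) = \<delta>"
    using Min_in[OF B] unfolding \<delta>_def by (force simp: B_def)
  have "0 \<le> \<delta>"
    using \<delta>_in u(2) by (fastforce simp: slack_def)
  then have e: "0 \<le> e" "e \<le> \<delta>" "e \<le> x K + y K - u K"
    using u(1)[of K] by (auto simp: e_def)
  define u' where "u' = u(K := u K + e)"
  have S: "sum u' {i..<k} = sum u {i..<k} + (if i \<le> K \<and> K < k then e else 0)" for i k
    unfolding u'_def by (rule sum_update)
  show ?case
  proof (intro exI[of _ u'] conjI allI impI)
    fix k
    show "x k \<le> u' k" "u' k \<le> x k + y k"
      using u(1)[of k] e by (auto simp: u'_def)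
  next
    fix i k
    assume "i \<le> k" "k \<le> m"
    then show "sum u' {i..<k} \<le> A + h k - h i"
      using u(2)[of i k] \<delta>_le[of i k] e by (auto simp: S slack_def)
  next
    fix l
    assume "l < Suc K"
    show "y l \<le> u' l \<or> (\<exists>i k. i \<le> l \<and> l < k \<and> k \<le> m \<and> sum u' {i..<k} = A + h k - h i)"
    proof (cases "l = K")
      case True
      show ?thesis
      proof (cases "e = \<delta>")
        case True
        then show ?thesis
          using \<delta>_in \<open>l = K\<close> by (fastforce simp: S slack_def)
      next
        case False
        then have "u' K = x K + y K"
          by (auto simp: u'_def e_def min_def split: if_splits)
        then show ?thesis
          using \<open>l = K\<close> x[of K] by simp
      qed
    next
      case False
      then have "l < K" using \<open>l < Suc K\<close> by simp
      then consider "y l \<le> u l" | i k where "i \<le> l" "l < k" "k \<le> m" "sum u {i..<k} = A + h k - h i"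
        using u(3) by blast
      then show ?thesis
      proof cases
        case 1
        then show ?thesis using False by (simp add: u'_def)
      next
        case 2
        have "sum u' {i..<k} = A + h k - h i"
        proof (cases "i \<le> K \<and> K < k")
          case True
          then have "e = 0"
            using \<delta>_le[of i k] 2 e by (simp add: slack_def)
          then show ?thesis using 2 by (simp add: S)
        qed (use 2 in \<open>auto simp: S\<close>)
        then show ?thesis using 2 by blast
      qed
    qed
  qed
qed

text \<open>
  The bound \<open>A + h k - h i\<close> is modular on overlapping blocks, so the union of two overlapping tight
  blocks is tight. Thus the indices split into disjoint tight blocks, on each of which the sum of \<open>u\<close>
  attains the bound that \<open>y\<close> obeys as well, and single indices with \<open>y l \<le> u l\<close>. The induction peels
  off the last part: the longest tight block that ends at \<open>m\<close>, or a single index.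
\<close>

lemma saturated_total:
  fixes u y h :: "nat \<Rightarrow> real"
  assumes cu: "\<And>i k. \<lbrakk>i \<le> k; k \<le> m\<rbrakk> \<Longrightarrow> sum u {i..<k} \<le> A + h k - h i"
    and cy: "\<And>i k. \<lbrakk>i \<le> k; k \<le> m\<rbrakk> \<Longrightarrow> sum y {i..<k} \<le> A + h k - h i"
    and sat: "\<And>l. l < m \<Longrightarrow>
      y l \<le> u l \<or> (\<exists>i k. i \<le> l \<and> l < k \<and> k \<le> m \<and> sum u {i..<k} = A + h k - h i)"
  shows "sum y {0..<m} \<le> sum u {0..<m}"
  using assms
proof (induction m rule: less_induct)
  case (less m)
  let ?tight = "\<lambda>i k. sum u {i..<k} = A + h k - h i"
  consider "m = 0" | "m > 0" "\<exists>i<m. ?tight i m" | "m > 0" "\<not> (\<exists>i<m. ?tight i m)"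
    by blast
  then show ?case
  proof cases
    case 2
    define i where "i = (LEAST i. i < m \<and> ?tight i m)"
    have i: "i < m" "?tight i m"
      using LeastI_ex[OF 2(2)] by (auto simp: i_def)
    have i_min: "\<not> (i' < i \<and> ?tight i' m)" for i'
      using not_less_Least[of i' "\<lambda>i. i < m \<and> ?tight i m"] i(1) by (auto simp: i_def)
    \<comment> \<open>Two overlapping tight intervals have a tight union, so by minimality of \<open>i\<close> none crosses \<open>i\<close>.\<close>
    have no_cross: "k \<le> i" if "i' < i" "i' < k" "k \<le> m" "?tight i' k" for i' k
    proof (rule ccontr)
      assume "\<not> k \<le> i"
      then have "sum u {i'..<m} + sum u {i..<k} = sum u {i'..<k} + sum u {i..<m}"
        using that sum.atLeastLessThan_concat[of i' k m u] sum.atLeastLessThan_concat[of i k m u] by simp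
      then have "sum u {i'..<m} \<ge> A + h m - h i'"
        using that i less.prems(1)[of i k] \<open>\<not> k \<le> i\<close> by simp
      then have "?tight i' m"
        using less.prems(1)[of i' m] that by simp
      then show False
        using i_min that(1) by blast
    qed
    have "sum y {0..<i} \<le> sum u {0..<i}"
    proof (rule less.IH)
      fix l
      assume "l < i"
      then show "y l \<le> u l \<or> (\<exists>i' k. i' \<le> l \<and> l < k \<and> k \<le> i \<and> ?tight i' k)"
        using less.prems(3)[of l] i(1) no_cross by (meson le_less_trans less_trans)
    qed (use less.prems i in auto)
    moreover have "sum y {i..<m} \<le> sum u {i..<m}"
      using i less.prems(2)[of i m] by simp
    ultimately show ?thesis
      using i sum.atLeastLessThan_concat[of 0 i m u] sum.atLeastLessThan_concat[of 0 i m y] by simp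
  next
    case 3
    define n where "n = m - 1"
    have n: "m = Suc n" "n < m" using 3 by (auto simp: n_def)
    have "sum y {0..<n} \<le> sum u {0..<n}"
    proof (rule less.IH)
      fix l
      assume "l < n"
      then show "y l \<le> u l \<or> (\<exists>i' k. i' \<le> l \<and> l < k \<and> k \<le> n \<and> ?tight i' k)"
        using less.prems(3)[of l] n 3(2) by (metis le_SucE le_less_trans less_SucI)
    qed (use less.prems n in auto)
    moreover have "y n \<le> u n"
      using less.prems(3)[of n] n 3(2) by (metis Suc_leI le_antisym le_imp_less_Suc)
    ultimately show ?thesis
      using n by simp
  qed simp
qed

text \<open>
  This is the augmentation property of the polymatroid of admissible vectors. The saturated vector
  has too large a total in general; by convexity a point on the segment from \<open>x\<close> to it has the right one.
\<close>

lemma augmentation: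
  fixes x y h :: "nat \<Rightarrow> real"
  assumes y: "\<And>k. 0 \<le> y k" and x: "\<And>k. 0 \<le> x k"
    and cx: "\<And>i k. \<lbrakk>i \<le> k; k \<le> m\<rbrakk> \<Longrightarrow> sum x {i..<k} \<le> A + h k - h i"
    and cy: "\<And>i k. \<lbrakk>i \<le> k; k \<le> m\<rbrakk> \<Longrightarrow> sum y {i..<k} \<le> A + h k - h i"
    and xy: "sum x {0..<m} \<le> sum y {0..<m}"
  obtains u where "\<And>k. x k \<le> u k" "\<And>k. u k \<le> x k + y k"
    "\<And>i k. \<lbrakk>i \<le> k; k \<le> m\<rbrakk> \<Longrightarrow> sum u {i..<k} \<le> A + h k - h i"
    "sum u {0..<m} = sum y {0..<m}"
proof -
  obtain v where v: "\<And>k. x k \<le> v k" "\<And>k. v k \<le> x k + y k"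
    "\<And>i k. \<lbrakk>i \<le> k; k \<le> m\<rbrakk> \<Longrightarrow> sum v {i..<k} \<le> A + h k - h i"
    "\<And>l. l < m \<Longrightarrow> y l \<le> v l \<or> (\<exists>i k. i \<le> l \<and> l < k \<and> k \<le> m \<and> sum v {i..<k} = A + h k - h i)"
    using saturate[of y x m A h m, OF y x cx] by auto
  have yv: "sum y {0..<m} \<le> sum v {0..<m}"
    by (rule saturated_total[OF v(3) cy v(4)])
  obtain \<theta> where \<theta>: "0 \<le> \<theta>" "\<theta> \<le> 1"
    "sum x {0..<m} + \<theta> * (sum v {0..<m} - sum x {0..<m}) = sum y {0..<m}"
  proof (cases "sum v {0..<m} = sum x {0..<m}")
    case True
    then show thesis using that[of 0] xy yv by simp
  next
    case False
    then show thesis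
      using that[of "(sum y {0..<m} - sum x {0..<m}) / (sum v {0..<m} - sum x {0..<m})"] xy yv
      by (auto simp: divide_simps)
  qed
  define u where "u k = (1 - \<theta>) * x k + \<theta> * v k" for k
  have su: "sum u {i..<k} = (1 - \<theta>) * sum x {i..<k} + \<theta> * sum v {i..<k}" for i k
    by (simp add: u_def sum.distrib sum_distrib_left)
  show thesis
  proof (rule that[of u])
    fix k
    have "x k \<le> (1 - \<theta>) * x k + \<theta> * v k"
      using mult_left_mono[OF v(1)[of k] \<theta>(1)] by (simp add: algebra_simps)
    then show "x k \<le> u k" by (simp add: u_def)
    have "(1 - \<theta>) * x k + \<theta> * v k \<le> (1 - \<theta>) * (x k + y k) + \<theta> * (x k + y k)"
      using \<theta> y[of k] v(2)[of k] by (intro add_mono mult_left_mono) auto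
    then show "u k \<le> x k + y k" by (simp add: u_def algebra_simps)
  next
    fix i k
    assume "i \<le> k" "k \<le> m"
    then have "(1 - \<theta>) * sum x {i..<k} + \<theta> * sum v {i..<k}
        \<le> (1 - \<theta>) * (A + h k - h i) + \<theta> * (A + h k - h i)"
      using \<theta> cx v(3) by (intro add_mono mult_left_mono) auto
    then show "sum u {i..<k} \<le> A + h k - h i"
      by (simp add: su algebra_simps)
  next
    show "sum u {0..<m} = sum y {0..<m}"
      using \<theta>(3) by (simp add: su algebra_simps)
  qed
qed

section \<open>Exchanging two completion times\<close>

lemma finite_enumeration:
  fixes G :: "real set"
  assumes "finite G" "G \<noteq> {}"
  obtains m :: nat and e :: "nat \<Rightarrow> real" where "strict_mono_on {0..m} e" "G = e ` {0..m}"
proof -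
  define e where "e k = sorted_list_of_set G ! k" for k
  define m where "m = card G - 1"
  have len: "length (sorted_list_of_set G) = Suc m"
    using assms by (simp add: m_def card_gt_0_iff)
  have "strict_mono_on {0..m} e"
    using sorted_wrt_nth_less[OF strict_sorted_list_of_set[of G]] len
    by (auto simp: strict_mono_on_def e_def)
  moreover have "e ` {0..m} = set (sorted_list_of_set G)"
    unfolding set_conv_nth len e_def by force
  ultimately show thesis
    using that assms by simp
qed

text \<open>
  Cumulative work on the grid corresponds to the vector of its increments; the scaling by \<open>\<gamma>\<close> and
  the linear term \<open>- \<alpha> * t / \<gamma>\<close> bring the thermal condition into the form of the polymatroid bound.
\<close>

lemma augmentation_on_grid:
  fixes X Y :: "real \<Rightarrow> real"
  assumes G: "finite G" "0 \<in> G" "\<And>g. g \<in> G \<Longrightarrow> 0 \<le> g" and M: "M \<in> G" "\<And>g. g \<in> G \<Longrightarrow> g \<le> M"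
    and "\<gamma> > 0"
    and X: "X 0 = 0" "\<And>s t. \<lbrakk>s \<in> G; t \<in> G; s \<le> t\<rbrakk> \<Longrightarrow> X s \<le> X t \<and> \<gamma> * (X t - X s) \<le> 1 - \<alpha> * (t - s)"
    and Y: "Y 0 = 0" "\<And>s t. \<lbrakk>s \<in> G; t \<in> G; s \<le> t\<rbrakk> \<Longrightarrow> Y s \<le> Y t \<and> \<gamma> * (Y t - Y s) \<le> 1 - \<alpha> * (t - s)"
    and XY: "X M \<le> Y M"
  obtains U where "U 0 = 0" "U M = Y M"
    "\<And>s t. \<lbrakk>s \<in> G; t \<in> G; s \<le> t\<rbrakk> \<Longrightarrow> X t - X s \<le> U t - U s \<and> U t - U s \<le> (X t - X s) + (Y t - Y s)
      \<and> \<gamma> * (U t - U s) \<le> 1 - \<alpha> * (t - s)"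
proof -
  have "G \<noteq> {}"
    using G(2) by auto
  with G(1) obtain m :: nat and e where e: "strict_mono_on {0..m} e" "G = e ` {0..m}"
    by (rule finite_enumeration)
  have less: "e i < e k" if "i < k" "k \<le> m" for i k
    using e(1) that by (auto simp: strict_mono_on_def)
  have le: "e i \<le> e k" if "i \<le> k" "k \<le> m" for i k
    using less[of i k] that by (cases "i = k") auto
  have inG: "e k \<in> G" if "k \<le> m" for k
    using e(2) that by auto
  have e0: "e 0 = 0"
  proof -
    obtain k where "k \<le> m" "e k = 0"
      using G(2) e(2) by auto
    then show ?thesis
      using le[of 0 k] G(3)[OF inG[of 0]] by simp
  qed
  have em: "e m = M"
  proof -
    obtain k where "k \<le> m" "e k = M"
      using M(1) e(2) by auto
    then show ?thesis
      using le[of k m] M(2)[OF inG[of m]] by simp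
  qed
  define x where "x k = (if k < m then X (e (Suc k)) - X (e k) else 0)" for k
  define y where "y k = (if k < m then Y (e (Suc k)) - Y (e k) else 0)" for k
  have tele: "(\<Sum>l\<in>{i..<k}. if l < m then Z (e (Suc l)) - Z (e l) else 0) = Z (e k) - Z (e i)"
    if "i \<le> k" "k \<le> m" for i k and Z :: "real \<Rightarrow> real"
  proof -
    have "(\<Sum>l\<in>{i..<k}. if l < m then Z (e (Suc l)) - Z (e l) else 0) = (\<Sum>l\<in>{i..<k}. Z (e (Suc l)) - Z (e l))"
      using that by (intro sum.cong) auto
    then show ?thesis
      using sum_Suc_diff'[OF that(1), of "\<lambda>l. Z (e l)"] by simp
  qed
  have sx: "sum x {i..<k} = X (e k) - X (e i)" and sy: "sum y {i..<k} = Y (e k) - Y (e i)" if "i \<le> k" "k \<le> m" for i k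
    using tele[OF that] by (simp_all add: x_def y_def)
  define h where "h k = - \<alpha> * e k / \<gamma>" for k
  have scale: "(\<gamma> * z \<le> 1 - \<alpha> * (e k - e i)) = (z \<le> 1 / \<gamma> + h k - h i)" for z i k
    using \<open>\<gamma> > 0\<close> by (simp add: h_def field_simps)
  have nonneg: "0 \<le> y k" "0 \<le> x k" for k
  proof -
    have "X (e k) \<le> X (e (Suc k)) \<and> Y (e k) \<le> Y (e (Suc k))" if "k < m"
    proof -
      have "e k \<in> G" "e (Suc k) \<in> G" "e k \<le> e (Suc k)"
        using inG[of k] inG[of "Suc k"] le[of k "Suc k"] that by simp_all
      from X(2)[OF this] Y(2)[OF this] show ?thesis
        by blast
    qed
    then show "0 \<le> y k" "0 \<le> x k"
      by (simp_all add: x_def y_def)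
  qed
  have cx: "sum x {i..<k} \<le> 1 / \<gamma> + h k - h i" and cy: "sum y {i..<k} \<le> 1 / \<gamma> + h k - h i"
    if "i \<le> k" "k \<le> m" for i k
  proof -
    have ik: "e i \<in> G" "e k \<in> G" "e i \<le> e k"
      using inG[of i] inG[of k] le[of i k] that by simp_all
    show "sum x {i..<k} \<le> 1 / \<gamma> + h k - h i"
      using X(2)[OF ik] scale sx[OF that] by metis
    show "sum y {i..<k} \<le> 1 / \<gamma> + h k - h i"
      using Y(2)[OF ik] scale sy[OF that] by metis
  qed
  have "sum x {0..<m} \<le> sum y {0..<m}"
    using XY X(1) Y(1) by (simp add: sx sy e0 em)
  then obtain u where u: "\<And>k. x k \<le> u k" "\<And>k. u k \<le> x k + y k"
    "\<And>i k. \<lbrakk>i \<le> k; k \<le> m\<rbrakk> \<Longrightarrow> sum u {i..<k} \<le> 1 / \<gamma> + h k - h i"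
    "sum u {0..<m} = sum y {0..<m}"
    using augmentation[of y x m "1 / \<gamma>" h, OF nonneg cx cy] by blast
  define U where "U t = sum u {0..<the_inv_into {0..m} e t}" for t
  have inj: "inj_on e {0..m}"
    using e(1) by (rule strict_mono_on_imp_inj_on)
  have U: "U (e k) = sum u {0..<k}" if "k \<le> m" for k
    using the_inv_into_f_f[OF inj, of k] that by (simp add: U_def)
  have inc: "U (e k) - U (e i) = sum u {i..<k}" if "i \<le> k" "k \<le> m" for i k
    using sum.atLeastLessThan_concat[of 0 i k u] that by (simp add: U)
  show thesis
  proof (rule that[of U])
    show "U 0 = 0"
      using U[of 0] e0 by simp
    show "U M = Y M"
      using U[of m] em e0 u(4) sy[of 0 m] Y(1) by simp
    fix s t
    assume "s \<in> G" "t \<in> G" "s \<le> t"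
    then obtain i k where ik: "i \<le> m" "k \<le> m" "s = e i" "t = e k"
      using e(2) by auto
    then have "i \<le> k"
      using less[of k i] \<open>s \<le> t\<close> by (cases "k < i") auto
    have "sum x {i..<k} \<le> sum u {i..<k}" "sum u {i..<k} \<le> sum x {i..<k} + sum y {i..<k}"
      using u(1,2) by (auto simp flip: sum.distrib intro!: sum_mono)
    then show "X t - X s \<le> U t - U s \<and> U t - U s \<le> (X t - X s) + (Y t - Y s)
      \<and> \<gamma> * (U t - U s) \<le> 1 - \<alpha> * (t - s)"
      using u(3)[of i k] inc[of i k] sx[of i k] sy[of i k] scale[of "U t - U s" k i] ik \<open>i \<le> k\<close> by simp
  qed
qed

text \<open>
  Job \<open>j\<close> receives the augmentation \<open>U\<close> of \<open>W i\<close> from \<open>W j\<close>, and \<open>i\<close> receives what remains of the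
  common work of the two jobs.
\<close>

lemma plan_swap:
  fixes J :: "'j set"
  assumes fin: "finite J" and rates: "\<alpha> < \<beta>" and P: "plan \<alpha> \<beta> J p c W"
    and ij: "i \<in> J" "j \<in> J" "p i < p j" "c j < c i"
  shows "\<exists>W'. plan \<alpha> \<beta> J p (c(i := c j, j := c i)) W'"
proof -
  define G where "G = grid J c"
  define c' where "c' = c(i := c j, j := c i)"
  have "i \<noteq> j" using ij by auto
  have img: "c' ` J = c ` J"
    using ij by (force simp: c'_def image_iff)
  then have grid: "grid J c' = G"
    by (simp add: grid_def G_def)
  have G: "finite G" "0 \<in> G" "\<And>g. g \<in> G \<Longrightarrow> 0 \<le> g" "c i \<in> G" "c j \<in> G"
    using fin P ij by (auto simp: G_def grid_def plan_def)
  have start: "W k 0 = 0" and stop: "\<And>g. \<lbrakk>g \<in> G; c k \<le> g\<rbrakk> \<Longrightarrow> W k g = p k" if "k \<in> J" for k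
    using P that by (auto simp: plan_def G_def)
  have step: "W k s \<le> W k t \<and> (\<beta> - \<alpha>) * (W k t - W k s) \<le> 1 - \<alpha> * (t - s)"
    if "k \<in> J" "s \<in> G" "t \<in> G" "s \<le> t" for k s t
    using P that by (auto simp: plan_def G_def)
  have total: "(\<Sum>k\<in>J. W k t - W k s) \<le> t - s" if "s \<in> G" "t \<in> G" "s \<le> t" for s t
    using P that by (auto simp: plan_def G_def)
  define M where "M = Max G"
  have M: "M \<in> G" "\<And>g. g \<in> G \<Longrightarrow> g \<le> M"
    using G by (auto simp: M_def intro: Max_in)
  have WM: "W i M = p i" "W j M = p j"
    using stop M ij G by auto
  obtain U where U: "U 0 = 0" "U M = W j M"
    "\<And>s t. \<lbrakk>s \<in> G; t \<in> G; s \<le> t\<rbrakk> \<Longrightarrow> W i t - W i s \<le> U t - U s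
      \<and> U t - U s \<le> (W i t - W i s) + (W j t - W j s)
      \<and> (\<beta> - \<alpha>) * (U t - U s) \<le> 1 - \<alpha> * (t - s)"
    using augmentation_on_grid[OF G(1-3) M, of "\<beta> - \<alpha>" "W i" \<alpha> "W j"] rates start step ij WM by auto
  define V where "V t = W i t + W j t - U t" for t
  have V: "0 \<le> V t - V s \<and> V t - V s \<le> W j t - W j s" if "s \<in> G" "t \<in> G" "s \<le> t" for s t
    using U(3)[OF that] by (simp add: V_def)
  define W' where "W' = W(i := V, j := U)"
  have W': "W' i = V" "W' j = U" "\<And>k. \<lbrakk>k \<noteq> i; k \<noteq> j\<rbrakk> \<Longrightarrow> W' k = W k"
    using \<open>i \<noteq> j\<close> by (auto simp: W'_def)
  have c': "c' i = c j" "c' j = c i" "\<And>k. \<lbrakk>k \<noteq> i; k \<noteq> j\<rbrakk> \<Longrightarrow> c' k = c k"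
    using \<open>i \<noteq> j\<close> by (auto simp: c'_def)
  have split: "sum F J = F i + F j + sum F (J - {i, j})" for F :: "'j \<Rightarrow> real"
    using fin ij \<open>i \<noteq> j\<close> by (simp add: sum.remove[of J i] sum.remove[of "J - {i}" j] insert_commute flip: Diff_insert)
  have "plan \<alpha> \<beta> J p c' W'"
    unfolding plan_def grid
  proof (intro conjI ballI impI)
    fix k
    assume k: "k \<in> J"
    show "0 \<le> c' k"
      using k img G(3) by (force simp: G_def grid_def)
    show "W' k 0 = 0"
      using ij k by (cases "k = i"; cases "k = j") (simp_all add: W' V_def U(1) start)
    fix g
    assume g: "g \<in> G" "c' k \<le> g"
    consider "k = i" | "k = j" | "k \<noteq> i" "k \<noteq> j" by blast
    then show "W' k g = p k"
    proof cases
      case 1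
      then have "W j g = p j"
        using stop[of j] g c' ij by auto
      then have "V M - V g = 0"
        using V[of g M] M g WM by force
      then show ?thesis
        using U(2) WM 1 W' by (simp add: V_def)
    next
      case 2
      then have "W j g = p j" "W i g = p i"
        using stop[of j] stop[of i] g c' ij by auto
      then show ?thesis
        using U(3)[of g M] U(2) WM M g 2 W' by force
    qed (use stop k g W' c' in auto)
  next
    fix s t k
    assume st: "s \<in> G" "t \<in> G" "s \<le> t" and k: "k \<in> J"
    consider "k = i" | "k = j" | "k \<noteq> i" "k \<noteq> j" by blast
    then have "W' k s \<le> W' k t \<and> (\<beta> - \<alpha>) * (W' k t - W' k s) \<le> 1 - \<alpha> * (t - s)"
    proof cases
      case 1
      have "(\<beta> - \<alpha>) * (V t - V s) \<le> (\<beta> - \<alpha>) * (W j t - W j s)"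
        using V[OF st] rates by (intro mult_left_mono) auto
      then show ?thesis
        using V[OF st] step[OF ij(2) st] W' 1 by auto
    next
      case 2
      then show ?thesis
        using U(3)[OF st] step[OF ij(1) st] W' by auto
    qed (use step k st W' in auto)
    then show "W' k s \<le> W' k t" "(\<beta> - \<alpha>) * (W' k t - W' k s) \<le> 1 - \<alpha> * (t - s)" by auto
  next
    fix s t
    assume st: "s \<in> G" "t \<in> G" "s \<le> t"
    have "(\<Sum>k\<in>J. W' k t - W' k s) = (\<Sum>k\<in>J. W k t - W k s)"
      unfolding split using W' by (simp add: V_def)
    then show "(\<Sum>k\<in>J. W' k t - W' k s) \<le> t - s"
      using total[OF st] by simp
  qed
  then show ?thesis
    unfolding c'_def by blast
qed

section \<open>Piecewise constant loads\<close>

definition prev_point :: "real set \<Rightarrow> real \<Rightarrow> real" where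
  "prev_point G t = Max {g \<in> G. g \<le> t}"

definition next_point :: "real set \<Rightarrow> real \<Rightarrow> real" where
  "next_point G t = Min {g \<in> G. t < g}"

text \<open>
  The load that spreads the work of \<open>w\<close> evenly between neighbouring grid points; the machine idles
  after the last of them.
\<close>

definition slope :: "real set \<Rightarrow> (real \<Rightarrow> real) \<Rightarrow> real \<Rightarrow> real" where
  "slope G w t = (if \<exists>g\<in>G. t < g
     then (w (next_point G t) - w (prev_point G t)) / (next_point G t - prev_point G t) else 0)"

definition interpolation :: "real set \<Rightarrow> (real \<Rightarrow> real) \<Rightarrow> real \<Rightarrow> real" where
  "interpolation G w t = w (prev_point G t) + slope G w t * (t - prev_point G t)"

text \<open>
  For two times with the same past grid points, the functions above refer to the same neighbouring
  grid points, so that the interpolation is affine on such a piece.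
\<close>

definition same_piece :: "real set \<Rightarrow> real \<Rightarrow> real \<Rightarrow> bool" where
  "same_piece G t u \<longleftrightarrow> (\<forall>g\<in>G. g \<le> u \<longleftrightarrow> g \<le> t)"

lemma same_piece_eq:
  assumes "same_piece G t u"
  shows "{g \<in> G. g \<le> u} = {g \<in> G. g \<le> t}" "prev_point G u = prev_point G t"
    "next_point G u = next_point G t" "slope G w u = slope G w t"
proof -
  have le: "{g \<in> G. g \<le> u} = {g \<in> G. g \<le> t}"
    using assms by (auto simp: same_piece_def)
  have "u < g \<longleftrightarrow> t < g" if "g \<in> G" for g
    using assms that by (force simp: same_piece_def simp flip: not_le)
  then have less: "{g \<in> G. u < g} = {g \<in> G. t < g}" "(\<exists>g\<in>G. u < g) = (\<exists>g\<in>G. t < g)"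
    by auto
  show "{g \<in> G. g \<le> u} = {g \<in> G. g \<le> t}" by (rule le)
  show pn: "prev_point G u = prev_point G t" "next_point G u = next_point G t"
    unfolding prev_point_def next_point_def le less by auto
  show "slope G w u = slope G w t"
    unfolding slope_def pn less by simp
qed

context
  fixes G :: "real set"
  assumes G: "finite G" "0 \<in> G" "\<And>g. g \<in> G \<Longrightarrow> 0 \<le> g"
begin

lemma prev_point:
  assumes "0 \<le> t"
  shows "prev_point G t \<in> G" "prev_point G t \<le> t" "\<And>g. \<lbrakk>g \<in> G; g \<le> t\<rbrakk> \<Longrightarrow> g \<le> prev_point G t"
    "0 \<le> prev_point G t"
proof -
  have fin: "finite {g \<in> G. g \<le> t}" and ne: "{g \<in> G. g \<le> t} \<noteq> {}"
    using G assms by auto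
  show "prev_point G t \<in> G" "prev_point G t \<le> t"
    using Max_in[OF fin ne] by (auto simp: prev_point_def)
  then show "0 \<le> prev_point G t"
    using G(3) by blast
  show "g \<le> prev_point G t" if "g \<in> G" "g \<le> t" for g
    unfolding prev_point_def using that by (intro Max_ge fin) auto
qed

lemma prev_point_eq: "g \<in> G \<Longrightarrow> prev_point G g = g"
  using prev_point[of g] G(3)[of g] by fastforce

lemma next_point:
  assumes "\<exists>g\<in>G. t < g"
  shows "next_point G t \<in> G" "t < next_point G t" "\<And>g. \<lbrakk>g \<in> G; t < g\<rbrakk> \<Longrightarrow> next_point G t \<le> g"
proof -
  have fin: "finite {g \<in> G. t < g}" and ne: "{g \<in> G. t < g} \<noteq> {}"
    using G assms by auto
  show "next_point G t \<in> G" "t < next_point G t"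
    using Min_in[OF fin ne] by (auto simp: next_point_def)
  show "next_point G t \<le> g" if "g \<in> G" "t < g" for g
    unfolding next_point_def using that by (intro Min_le fin) auto
qed

lemma same_pieceI:
  assumes "0 \<le> t" "prev_point G t \<le> u" "\<And>g. \<lbrakk>g \<in> G; t < g\<rbrakk> \<Longrightarrow> u < g"
  shows "same_piece G t u"
  unfolding same_piece_def
proof (intro ballI iffI)
  fix g
  assume g: "g \<in> G"
  show "g \<le> t" if "g \<le> u"
    using assms(3)[OF g] that by (meson not_le)
  show "g \<le> u" if "g \<le> t"
    using prev_point(3)[OF assms(1) g that] assms(2) by simp
qed

lemma open_piece:
  assumes "0 \<le> t" "t \<notin> G"
  obtains B where "open B" "t \<in> B" "\<And>u. u \<in> B \<Longrightarrow> same_piece G t u" "\<And>u. u \<in> B \<Longrightarrow> 0 < u"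
proof -
  have prev: "prev_point G t < t"
    using prev_point[OF assms(1)] assms(2) by (metis less_le)
  define B where "B = {prev_point G t<..} \<inter> (\<Inter>g\<in>{g \<in> G. t < g}. {..<g})"
  have "open B"
    unfolding B_def using G(1) by (intro open_Int open_INT) auto
  moreover have "t \<in> B"
    using prev by (auto simp: B_def)
  moreover have "same_piece G t u" if "u \<in> B" for u
    using that by (intro same_pieceI[OF assms(1)]) (auto simp: B_def)
  moreover have "0 < u" if "u \<in> B" for u
    using that prev_point(4)[OF assms(1)] by (auto simp: B_def)
  ultimately show thesis by (rule that)
qed

lemma interpolation_at: "g \<in> G \<Longrightarrow> interpolation G w g = w g"
  by (simp add: interpolation_def prev_point_eq)

lemma interpolation_same_piece:
  assumes "same_piece G t u"
  shows "interpolation G w u = w (prev_point G t) + slope G w t * (u - prev_point G t)"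
  by (simp add: interpolation_def same_piece_eq[OF assms])

lemma interpolation_next:
  assumes "0 \<le> t" "\<exists>g\<in>G. t < g"
  shows "w (next_point G t) = w (prev_point G t) + slope G w t * (next_point G t - prev_point G t)"
proof -
  have "prev_point G t < next_point G t"
    using prev_point[OF assms(1)] next_point[OF assms(2)] by linarith
  then show ?thesis
    using assms(2) by (simp add: slope_def)
qed

context
  fixes w :: "real \<Rightarrow> real"
  assumes w: "\<And>s t. \<lbrakk>s \<in> G; t \<in> G; s \<le> t\<rbrakk> \<Longrightarrow> w s \<le> w t \<and> w t - w s \<le> t - s"
begin

lemma slope_bounds:
  assumes "0 \<le> t"
  shows "0 \<le> slope G w t" "slope G w t \<le> 1"
proof -
  have "0 \<le> slope G w t \<and> slope G w t \<le> 1"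
  proof (cases "\<exists>g\<in>G. t < g")
    case True
    have "prev_point G t < next_point G t"
      using prev_point[OF assms(1)] next_point[OF True] by linarith
    then show ?thesis
      using w[OF prev_point(1)[OF assms] next_point(1)[OF True]] True by (auto simp: slope_def divide_simps)
  qed (simp add: slope_def)
  then show "0 \<le> slope G w t" "slope G w t \<le> 1" by auto
qed

lemma interpolation_increment:
  assumes "0 \<le> s" "s \<le> t"
  shows "0 \<le> interpolation G w t - interpolation G w s" "interpolation G w t - interpolation G w s \<le> t - s"
proof -
  have part: "0 \<le> slope G w u * d \<and> slope G w u * d \<le> d" if "0 \<le> d" "0 \<le> u" for u d
    using slope_bounds[OF that(2)] that(1) by (simp add: mult_left_le_one_le)
  have "0 \<le> interpolation G w t - interpolation G w s \<and> interpolation G w t - interpolation G w s \<le> t - s"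
  proof (cases "\<exists>g\<in>G. s < g \<and> g \<le> t")
    case False
    then have "same_piece G s t"
      using assms prev_point(2)[OF assms(1)] by (intro same_pieceI) force+
    then have "interpolation G w t - interpolation G w s = slope G w s * (t - s)"
      by (simp add: interpolation_same_piece[of s t] interpolation_def[of G w s] algebra_simps)
    then show ?thesis
      using part[of "t - s" s] assms by simp
  next
    case True
    then have ex: "\<exists>g\<in>G. s < g" by blast
    let ?a = "next_point G s" and ?b = "prev_point G t"
    have t: "0 \<le> t" using assms by simp
    obtain g where "g \<in> G" "s < g" "g \<le> t" using True by blast
    then have ab: "?a \<le> ?b"
      using next_point(3)[OF ex, of g] prev_point(3)[OF t, of g] by simp
    have "interpolation G w t - w ?b = slope G w t * (t - ?b)"
      by (simp add: interpolation_def)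
    moreover have "w ?a - interpolation G w s = slope G w s * (?a - s)"
      by (simp add: interpolation_next[OF assms(1) ex] interpolation_def algebra_simps)
    ultimately show ?thesis
      using part[of "t - ?b" t] part[of "?a - s" s] prev_point(2)[OF t] next_point(2)[OF ex] assms(1) t
        w[OF next_point(1)[OF ex] prev_point(1)[OF t] ab] by linarith
  qed
  then show "0 \<le> interpolation G w t - interpolation G w s" "interpolation G w t - interpolation G w s \<le> t - s"
    by auto
qed

lemma slope_has_integral:
  assumes "0 \<le> t"
  shows "(slope G w has_integral interpolation G w t - w 0) {0..t}"
proof -
  have "(slope G w has_integral interpolation G w t - interpolation G w 0) {0..t}"
  proof (rule fundamental_theorem_of_calculus_interior_strong[OF G(1) assms])
    fix x
    assume x: "x \<in> {0<..<t} - G"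
    obtain B where B: "open B" "x \<in> B" "\<And>u. u \<in> B \<Longrightarrow> same_piece G x u"
    proof -
      have "0 \<le> x" "x \<notin> G" using x by auto
      then show thesis
        using that by (rule open_piece)
    qed
    have "((\<lambda>u. w (prev_point G x) + slope G w x * (u - prev_point G x)) has_real_derivative slope G w x) (at x)"
      by (auto intro!: derivative_eq_intros)
    then have "(interpolation G w has_real_derivative slope G w x) (at x)"
      by (rule has_field_derivative_transform_within_open[OF _ B(1,2)]) (simp add: interpolation_same_piece[OF B(3)])
    then show "(interpolation G w has_vector_derivative slope G w x) (at x)"
      by (simp add: has_real_derivative_iff_has_vector_derivative)
  next
    have "1-lipschitz_on {0..t} (interpolation G w)"
    proof (rule lipschitz_onI)
      fix x y
      assume "x \<in> {0..t}" "y \<in> {0..t}"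
      then show "dist (interpolation G w x) (interpolation G w y) \<le> 1 * dist x y"
        using interpolation_increment[of x y] interpolation_increment[of y x]
        by (cases "x \<le> y") (auto simp: dist_real_def)
    qed simp
    then show "continuous_on {0..t} (interpolation G w)"
      by (rule lipschitz_on_continuous_on)
  qed
  then show ?thesis
    using G(2) by (simp add: interpolation_at)
qed


text \<open>
  The temperature is the net heat \<open>X\<close> minus its running minimum. As \<open>X\<close> is affine between grid
  points, the running minimum is attained at an earlier grid point or at the current time, whence
  the formula \<open>max 0 (X t - low t)\<close>. For the same reason the bound \<open>1\<close> has to be checked at grid
  points only. The differential law can only fail at grid points and at the times where \<open>X\<close> crosses its earlier
  minimum, at most once per piece.
\<close>

lemma temperature_of_slope:
  assumes rates: "\<alpha> < 0" "\<alpha> \<le> \<beta>"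
    and thermal: "\<And>s t. \<lbrakk>s \<in> G; t \<in> G; s \<le> t\<rbrakk> \<Longrightarrow> (\<beta> - \<alpha>) * (w t - w s) \<le> 1 - \<alpha> * (t - s)"
  shows "\<exists>T. is_temperature \<alpha> \<beta> (slope G w) T \<and> (\<forall>t\<ge>0. T t \<le> 1)"
proof -
  define X where "X t = \<alpha> * t + (\<beta> - \<alpha>) * interpolation G w t" for t
  define low where "low t = Min (X ` {g \<in> G. g \<le> t})" for t
  define T where "T t = max 0 (X t - low t)" for t
  define v where "v t = \<alpha> + (\<beta> - \<alpha>) * slope G w t" for t
  define L where "L = \<bar>\<alpha>\<bar> + (\<beta> - \<alpha>)"
  have L: "0 \<le> L" using rates by (simp add: L_def)
  have fin: "finite (X ` {g \<in> G. g \<le> t})" for t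
    using G(1) by simp
  have low_le: "low t \<le> X g" if "g \<in> G" "g \<le> t" for g t
    unfolding low_def using that by (intro Min_le fin) auto
  have low_in: "\<exists>g\<in>G. g \<le> t \<and> low t = X g" if "0 \<le> t" for t
  proof -
    have "X ` {g \<in> G. g \<le> t} \<noteq> {}"
      using G(2) that by auto
    from Min_in[OF fin this] show ?thesis
      by (auto simp: low_def)
  qed
  have X_lip: "\<bar>X t - X s\<bar> \<le> L * (t - s)" if "0 \<le> s" "s \<le> t" for s t
  proof -
    have "(\<beta> - \<alpha>) * (interpolation G w t - interpolation G w s) \<le> (\<beta> - \<alpha>) * (t - s)"
      using interpolation_increment[OF that] rates by (intro mult_left_mono) auto
    moreover have "0 \<le> (\<beta> - \<alpha>) * (interpolation G w t - interpolation G w s)"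
      using interpolation_increment[OF that] rates by simp
    moreover have "X t - X s = \<alpha> * (t - s) + (\<beta> - \<alpha>) * (interpolation G w t - interpolation G w s)"
      by (simp add: X_def algebra_simps)
    moreover have "L * (t - s) = - \<alpha> * (t - s) + (\<beta> - \<alpha>) * (t - s)"
      using rates by (simp add: L_def algebra_simps)
    moreover have "0 \<le> - \<alpha> * (t - s)" "0 \<le> (\<beta> - \<alpha>) * (t - s)"
      using rates that by (simp_all add: mult_nonpos_nonneg)
    ultimately show ?thesis by linarith
  qed
  have X_piece: "X u = X (prev_point G t) + v t * (u - prev_point G t)" if "0 \<le> t" "same_piece G t u" for t u
    using prev_point(1)[OF that(1)]
    by (simp add: X_def v_def interpolation_at interpolation_same_piece[OF that(2)] algebra_simps)
  have T0: "T 0 = 0"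
  proof -
    have "{g \<in> G. g \<le> 0} = {0}"
      using G by force
    then show ?thesis by (simp add: T_def low_def)
  qed
  have T_lip: "\<bar>T t - T s\<bar> \<le> L * (t - s)" if st: "0 \<le> s" "s \<le> t" for s t
  proof -
    obtain g where g: "g \<in> G" "g \<le> t" "low t = X g"
      using low_in[of t] st by auto
    obtain k where k: "k \<in> G" "k \<le> s" "low s = X k"
      using low_in[of s] st by blast
    have "X s - low s \<le> X t - low t + L * (t - s)"
      using X_lip[OF st] low_le[of k t] k st by auto
    moreover have "X t - low t \<le> max 0 (X s - low s) + L * (t - s)"
    proof (cases "g \<le> s")
      case True
      then show ?thesis
        using X_lip[OF st] low_le[of g s] g by linarith
    next
      case False
      have "X t - X g \<le> L * (t - g)"
        using X_lip[of g t] G(3)[of g] g by linarith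
      also have "\<dots> \<le> L * (t - s)"
        using L False by (intro mult_left_mono) auto
      finally show ?thesis
        using g by linarith
    qed
    moreover have "0 \<le> L * (t - s)"
      using L st by simp
    ultimately show ?thesis
      unfolding T_def by linarith
  qed
  have "abs_continuous_on 0 b T" for b
    unfolding abs_continuous_on_def
  proof (intro allI impI)
    fix \<epsilon> :: real
    assume "0 < \<epsilon>"
    show "\<exists>\<delta>>0. \<forall>D :: (real \<times> real) set.
        finite D \<and> (\<forall>(x, y)\<in>D. 0 \<le> x \<and> x \<le> y \<and> y \<le> b) \<and>
        pairwise (\<lambda>(x, y) (u, v). {x<..<y} \<inter> {u<..<v} = {}) D \<and>
        (\<Sum>(x, y)\<in>D. y - x) < \<delta>
        \<longrightarrow> (\<Sum>(x, y)\<in>D. \<bar>T y - T x\<bar>) < \<epsilon>"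
    proof (intro exI conjI allI impI)
      show "0 < \<epsilon> / (L + 1)"
        using \<open>0 < \<epsilon>\<close> L by simp
      fix D :: "(real \<times> real) set"
      assume D: "finite D \<and> (\<forall>(x, y)\<in>D. 0 \<le> x \<and> x \<le> y \<and> y \<le> b) \<and>
        pairwise (\<lambda>(x, y) (u, v). {x<..<y} \<inter> {u<..<v} = {}) D \<and>
        (\<Sum>(x, y)\<in>D. y - x) < \<epsilon> / (L + 1)"
      have "(\<Sum>(x, y)\<in>D. \<bar>T y - T x\<bar>) \<le> (\<Sum>(x, y)\<in>D. L * (y - x))"
        using D T_lip by (intro sum_mono) fastforce
      also have "\<dots> = L * (\<Sum>(x, y)\<in>D. y - x)"
        by (simp add: sum_distrib_left case_prod_beta)
      also have "\<dots> \<le> L * (\<epsilon> / (L + 1))"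
        using D L by (intro mult_left_mono) auto
      also have "\<dots> < \<epsilon>"
        using L \<open>0 < \<epsilon>\<close> by (simp add: field_simps)
      finally show "(\<Sum>(x, y)\<in>D. \<bar>T y - T x\<bar>) < \<epsilon>" .
    qed
  qed
  moreover have "AE t in lebesgue. 0 \<le> t \<longrightarrow>
      (T has_real_derivative (if T t > 0 then \<alpha> * (1 - slope G w t) + \<beta> * slope G w t
        else max 0 (\<alpha> * (1 - slope G w t) + \<beta> * slope G w t))) (at t within {0..})"
  proof (rule AE_I')
    \<comment> \<open>On a piece with rate \<open>v\<close> the affine function \<open>X - low\<close> has at most one zero unless it is constant.\<close>
    let ?E = "G \<union> (\<lambda>g. g + (low g - X g) / v g) ` G"
    show "?E \<in> null_sets lebesgue"
      using negligible_finite[of ?E] G(1) by (simp add: negligible_iff_null_sets)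
    have "(T has_real_derivative (if T t > 0 then \<alpha> * (1 - slope G w t) + \<beta> * slope G w t
        else max 0 (\<alpha> * (1 - slope G w t) + \<beta> * slope G w t))) (at t within {0..})"
      if t: "0 \<le> t" "t \<notin> ?E" for t
    proof -
      let ?g = "prev_point G t"
      obtain B where B: "open B" "t \<in> B" "\<And>u. u \<in> B \<Longrightarrow> same_piece G t u"
      proof -
        have "0 \<le> t" "t \<notin> G" using t by auto
        then show thesis
          using that by (rule open_piece)
      qed
      have low: "low u = low t" if "same_piece G t u" for u
        unfolding low_def same_piece_eq(1)[OF that] ..
      have g: "same_piece G t ?g"
        using prev_point[OF t(1)] by (intro same_pieceI[OF t(1)]) auto
      have "?g < t"
        using prev_point[OF t(1)] t(2) by (metis UnCI less_le)
      have gap: "0 \<le> X ?g - low t"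
        using low_le[OF prev_point(1,2)[OF t(1)]] by simp
      define y where "y u = X ?g - low t + v t * (u - ?g)" for u
      have Ty: "T u = max 0 (y u)" if "u \<in> B" for u
        using X_piece[OF t(1) B(3)[OF that]] low[OF B(3)[OF that]] by (simp add: T_def y_def)
      have dy: "(y has_real_derivative v t) (at t)"
        unfolding y_def by (auto intro!: derivative_eq_intros)
      have cy: "continuous_on UNIV y"
        unfolding y_def by (intro continuous_intros)
      have rate: "\<alpha> * (1 - slope G w t) + \<beta> * slope G w t = v t"
        by (simp add: v_def algebra_simps)
      consider "y t > 0" | "y t < 0" | "y t = 0" by linarith
      then have "(T has_real_derivative (if T t > 0 then v t else max 0 (v t))) (at t)"
      proof cases
        case 1
        have "(T has_real_derivative v t) (at t)"
        proof (rule has_field_derivative_transform_within_open[OF dy, of "B \<inter> {u. 0 < y u}"])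
          show "open (B \<inter> {u. 0 < y u})"
            using B(1) cy by (intro open_Int open_Collect_less) auto
        qed (use 1 B(2) Ty in auto)
        then show ?thesis
          using 1 Ty[OF B(2)] by simp
      next
        case 2
        have "(T has_real_derivative 0) (at t)"
        proof (rule has_field_derivative_transform_within_open[OF DERIV_const, of "B \<inter> {u. y u < 0}"])
          show "open (B \<inter> {u. y u < 0})"
            using B(1) cy by (intro open_Int open_Collect_less) auto
        qed (use 2 B(2) Ty in auto)
        moreover have "v t < 0"
        proof (rule ccontr)
          assume "\<not> v t < 0"
          then have "0 \<le> v t * (t - ?g)"
            using \<open>?g < t\<close> by simp
          then show False
            using 2 gap by (simp add: y_def)
        qed
        ultimately show ?thesis
          using 2 Ty[OF B(2)] by simp
      next
        case 3
        have "v t = 0"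
        proof (rule ccontr)
          assume "v t \<noteq> 0"
          then have "t = ?g + (low t - X ?g) / v t"
            using 3 by (simp add: y_def field_simps)
          moreover have "low t = low ?g" "v t = v ?g"
            using low[OF g] same_piece_eq(4)[OF g] by (simp_all add: v_def)
          ultimately have "t \<in> ?E"
            using prev_point(1)[OF t(1)] by auto
          then show False using t(2) by blast
        qed
        then have "y u = 0" for u
          using 3 by (simp add: y_def)
        then have "(T has_real_derivative 0) (at t)"
          using Ty by (intro has_field_derivative_transform_within_open[OF DERIV_const B(1,2)]) auto
        then show ?thesis
          using \<open>v t = 0\<close> by simp
      qed
      then show ?thesis
        unfolding rate by (rule has_field_derivative_at_within)
    qed
    then show "{t \<in> space lebesgue. \<not> (0 \<le> t \<longrightarrow>
      (T has_real_derivative (if T t > 0 then \<alpha> * (1 - slope G w t) + \<beta> * slope G w t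
        else max 0 (\<alpha> * (1 - slope G w t) + \<beta> * slope G w t))) (at t within {0..}))} \<subseteq> ?E"
      by blast
  qed
  ultimately have "is_temperature \<alpha> \<beta> (slope G w) T"
    unfolding is_temperature_def using T0 by (simp add: T_def)
  moreover have "T t \<le> 1" if t: "0 \<le> t" for t
  proof -
    let ?a = "prev_point G t" and ?b = "next_point G t"
    obtain g where g: "g \<in> G" "g \<le> t" "low t = X g"
      using low_in[OF t] by blast
    have a: "?a \<in> G" "?a \<le> t" "g \<le> ?a"
      using prev_point[OF t] g by auto
    have XG: "X k - X g \<le> 1" if "k \<in> G" "g \<le> k" for k
      using thermal[OF g(1) that] that g(1) by (simp add: X_def interpolation_at algebra_simps)
    have "same_piece G t t" by (simp add: same_piece_def)
    note Xt = X_piece[OF t this]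
    show ?thesis
    proof (cases "v t \<le> 0")
      case True
      then have "v t * (t - ?a) \<le> 0"
        using a by (simp add: mult_nonpos_nonneg)
      then show ?thesis
        using XG[OF a(1,3)] Xt g by (simp add: T_def)
    next
      case False
      then have ex: "\<exists>g\<in>G. t < g"
        using rates by (auto simp: v_def slope_def split: if_splits)
      have "X ?b = X ?a + v t * (?b - ?a)"
        unfolding X_def v_def interpolation_at[OF next_point(1)[OF ex]] interpolation_at[OF a(1)]
          interpolation_next[OF t ex, of w]
        by (simp add: algebra_simps)
      moreover have "v t * (t - ?a) \<le> v t * (?b - ?a)"
        using False next_point(2)[OF ex] by (intro mult_left_mono) auto
      ultimately show ?thesis
        using XG[OF next_point(1)[OF ex]] next_point(2)[OF ex] g Xt by (simp add: T_def)
    qed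
  qed
  ultimately show ?thesis by blast
qed

end
end

section \<open>From plans to normal schedules\<close>

lemma grid_props:
  assumes "finite J" "plan \<alpha> \<beta> J p c W"
  shows "finite (grid J c)" "0 \<in> grid J c" "\<And>g. g \<in> grid J c \<Longrightarrow> 0 \<le> g"
    "\<And>j. j \<in> J \<Longrightarrow> c j \<in> grid J c"
  using assms by (auto simp: grid_def plan_def)

lemma plan_increment:
  assumes "finite J" "plan \<alpha> \<beta> J p c W" "j \<in> J" "s \<in> grid J c" "t \<in> grid J c" "s \<le> t"
  shows "W j s \<le> W j t \<and> W j t - W j s \<le> t - s"
proof -
  have mono: "W k s \<le> W k t" if "k \<in> J" for k
    using assms that by (auto simp: plan_def)
  have "W j t - W j s \<le> (\<Sum>k\<in>J. W k t - W k s)"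
    using assms(1,3) mono by (intro member_le_sum) auto
  also have "\<dots> \<le> t - s"
    using assms by (auto simp: plan_def)
  finally show ?thesis
    using mono[OF assms(3)] by simp
qed

lemma plan_work_le:
  assumes "finite J" "plan \<alpha> \<beta> J p c W" "j \<in> J" "g \<in> grid J c"
  shows "W j g \<le> p j"
proof (cases "c j \<le> g")
  case True
  then show ?thesis using assms by (auto simp: plan_def)
next
  case False
  then have "W j g \<le> W j (c j)"
    using plan_increment[OF assms(1-4) grid_props(4)[OF assms(1-3)]] by simp
  also have "\<dots> = p j"
    using assms grid_props(4)[OF assms(1-3)] by (auto simp: plan_def)
  finally show ?thesis .
qed

text \<open>
  Each completion time moves back to the first grid point at which the job is finished. The new grid
  is a part of the old one, so the inequalities of the plan remain valid.
\<close>

lemma tight_plan: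
  assumes fin: "finite J" and P: "plan \<alpha> \<beta> J p c W"
  obtains c' where "plan \<alpha> \<beta> J p c' W" "\<And>j. j \<in> J \<Longrightarrow> c' j \<le> c j"
    "\<And>j g. \<lbrakk>j \<in> J; g \<in> grid J c'; g < c' j\<rbrakk> \<Longrightarrow> W j g < p j"
proof -
  note G = grid_props[OF fin P]
  define A where "A j = {g \<in> grid J c. W j g = p j}" for j
  define c' where "c' j = Min (A j)" for j
  have A: "finite (A j)" "c j \<in> A j" if "j \<in> J" for j
    using G(1) G(4)[OF that] P that by (auto simp: A_def plan_def)
  have c': "c' j \<in> A j" "\<And>g. g \<in> A j \<Longrightarrow> c' j \<le> g" if "j \<in> J" for j
  proof -
    have "A j \<noteq> {}" using A(2)[OF that] by auto
    then show "c' j \<in> A j"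
      unfolding c'_def using A(1)[OF that] by (rule Min_in[rotated])
  qed (use A(1)[OF that] in \<open>auto simp: c'_def\<close>)
  have sub: "grid J c' \<subseteq> grid J c"
    using c'(1) by (auto simp: grid_def A_def)
  show thesis
  proof (rule that[of c'])
    show "c' j \<le> c j" if "j \<in> J" for j
      using c'(2)[OF that A(2)[OF that]] .
    show "W j g < p j" if "j \<in> J" "g \<in> grid J c'" "g < c' j" for j g
    proof -
      have g: "g \<in> grid J c" using that(2) sub by blast
      then have "W j g \<noteq> p j"
        using c'(2)[OF that(1), of g] that(3) by (auto simp: A_def)
      then show ?thesis
        using plan_work_le[OF fin P that(1) g] by simp
    qed
    have "W j g = p j" if "j \<in> J" "g \<in> grid J c" "c' j \<le> g" for j g
    proof -
      have "c' j \<in> grid J c" "W j (c' j) = p j"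
        using c'(1)[OF that(1)] by (auto simp: A_def)
      then show ?thesis
        using plan_increment[OF fin P that(1), of "c' j" g] plan_work_le[OF fin P that(1,2)] that by simp
    qed
    moreover have "0 \<le> c' j" if "j \<in> J" for j
      using c'(1)[OF that] G(3) by (auto simp: A_def)
    ultimately show "plan \<alpha> \<beta> J p c' W"
      using P sub unfolding plan_def by (simp add: subset_eq)
  qed
qed

text \<open>
  The loads are the slopes of the interpolated work. Tightness makes the planned completion times the actual
  ones, which normality of the schedule depends on.
\<close>

lemma schedule_of_tight_plan:
  fixes J :: "'j set"
  assumes fin: "finite J" and rates: "\<alpha> < 0" "0 < \<beta>" and p: "\<And>j. j \<in> J \<Longrightarrow> 0 < p j"
    and P: "plan \<alpha> \<beta> J p c W"
    and tight: "\<And>j g. \<lbrakk>j \<in> J; g \<in> grid J c; g < c j\<rbrakk> \<Longrightarrow> W j g < p j"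
  shows "\<exists>S \<in> feasible_normal_schedules \<alpha> \<beta> J p. \<forall>j\<in>J. completion_time p S j = c j"
proof -
  define G where "G = grid J c"
  note G = grid_props[OF fin P, folded G_def]
  note W = plan_increment[OF fin P, folded G_def]
  define S where "S j = slope G (W j)" for j
  have W0: "W j 0 = 0" and Wc: "W j (c j) = p j" if "j \<in> J" for j
    using P that G(4)[OF that] by (auto simp: plan_def G_def)
  have int: "(S j has_integral interpolation G (W j) t) {0..t}" if "j \<in> J" "0 \<le> t" for j t
    using slope_has_integral[OF G(1-3) W[OF that(1)] that(2)] W0[OF that(1)] by (simp add: S_def)
  then have work: "work S j t = interpolation G (W j) t" if "j \<in> J" "0 \<le> t" for j t
    using that by (simp add: work_def integral_unique)
  have nonneg: "0 \<le> S j t" if "j \<in> J" "0 \<le> t" for j t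
    using slope_bounds(1)[OF G(1-3) W[OF that(1)] that(2)] by (simp add: S_def)
  have sched: "schedule J S"
    unfolding schedule_def
  proof (intro ballI conjI allI impI)
    fix j and b :: real
    assume "j \<in> J" "0 \<le> b"
    then show "S j absolutely_integrable_on {0..b}"
      using int nonneg by (intro nonnegative_absolutely_integrable_1) auto
  qed (rule nonneg)
  have "manageable J S"
    unfolding manageable_def
  proof (intro allI impI)
    fix t :: real
    assume t: "0 \<le> t"
    show "(\<Sum>j\<in>J. S j t) \<le> 1"
    proof (cases "\<exists>g\<in>G. t < g")
      case True
      let ?a = "prev_point G t" and ?b = "next_point G t"
      have ab: "?a \<in> G" "?b \<in> G" "?a < ?b"
        using prev_point[OF G(1-3) t] next_point[OF G(1-3) True] by auto
      then have "(\<Sum>j\<in>J. W j ?b - W j ?a) \<le> ?b - ?a"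
        using P by (auto simp: plan_def G_def)
      then show ?thesis
        using True ab(3) by (simp add: S_def slope_def flip: sum_divide_distrib)
    qed (simp add: S_def slope_def)
  qed
  moreover have "\<exists>T. is_temperature \<alpha> \<beta> (S j) T \<and> (\<forall>t\<ge>0. T t \<le> 1)" if "j \<in> J" for j
    unfolding S_def
  proof (rule temperature_of_slope[OF G(1-3) W[OF that]])
    show "(\<beta> - \<alpha>) * (W j t - W j s) \<le> 1 - \<alpha> * (t - s)" if "s \<in> G" "t \<in> G" "s \<le> t" for s t
      using P that \<open>j \<in> J\<close> by (auto simp: plan_def G_def)
  qed (use rates in auto)
  ultimately have feas: "feasible \<alpha> \<beta> J S"
    by (simp add: feasible_def)
  have c: "0 \<le> c j" "c j \<in> G" "work S j (c j) = p j" if "j \<in> J" for j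
    using G(3,4) that work[OF that, of "c j"] Wc[OF that] interpolation_at[OF G(1-3), of "c j" "W j"] by auto
  have c_pos: "0 < c j" if "j \<in> J" for j
    using c(1)[OF that] Wc[OF that] W0[OF that] p[OF that] by (cases "c j = 0") auto
  \<comment> \<open>Before its planned completion, the work lies on a segment that starts below \<open>p j\<close> and ends at most at \<open>p j\<close>.\<close>
  have before: "work S j t < p j" if j: "j \<in> J" and t: "0 \<le> t" "t < c j" for j t
  proof -
    let ?a = "prev_point G t" and ?b = "next_point G t"
    have ex: "\<exists>g\<in>G. t < g" using c(2)[OF j] t by blast
    have a: "?a \<in> G" "?a \<le> t" and b: "?b \<in> G" "t < ?b" "?b \<le> c j"
      using prev_point[OF G(1-3) t(1)] next_point[OF G(1-3) ex] c(2)[OF j] t by auto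
    have Wa: "W j ?a < p j"
      using tight[OF j] a t by (simp add: G_def)
    have Wb: "W j ?b \<le> p j"
      using W[OF j b(1) c(2)[OF j] b(3)] Wc[OF j] by simp
    have Wab: "W j ?b = W j ?a + S j t * (?b - ?a)"
      unfolding S_def by (rule interpolation_next[OF G(1-3) t(1) ex])
    have "work S j t = W j ?a + S j t * (t - ?a)"
      using work[OF j t(1)] by (simp add: interpolation_def S_def)
    also have "\<dots> < p j"
    proof (cases "S j t = 0")
      case False
      then have "S j t * (t - ?a) < S j t * (?b - ?a)"
        using nonneg[OF j t(1)] b by simp
      then show ?thesis using Wab Wb by linarith
    qed (use Wa in simp)
    finally show ?thesis .
  qed
  have compl: "completion_time p S j = c j" if "j \<in> J" for j
    unfolding completion_time_def
  proof (rule Least_equality)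
    fix t
    assume "0 \<le> t \<and> p j \<le> work S j t"
    then show "c j \<le> t"
      using before[OF that, of t] by force
  qed (use c[OF that] in auto)
  have "all_completed J p S"
    unfolding all_completed_def using c by fastforce
  moreover have "normal_schedule J p S"
  proof -
    have "G \<noteq> {}" using G(2) by auto
    with G(1) obtain m :: nat and e where e: "strict_mono_on {0..m} e" "G = e ` {0..m}"
      by (rule finite_enumeration)
    have less: "e i < e k" if "i < k" "k \<le> m" for i k
      using e(1) that by (auto simp: strict_mono_on_def)
    have inG: "e k \<in> G" if "k \<le> m" for k
      using e(2) that by auto
    have e0: "e 0 = 0"
    proof -
      obtain k where k: "k \<le> m" "e k = 0"
        using G(2) e(2) by auto
      have "0 \<le> e 0"
        using G(3)[OF inG[of 0]] by simp
      then show ?thesis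
        using k less[of 0 k] by (cases "k = 0") auto
    qed
    have "completion_time p S ` J = c ` J"
      using compl by simp
    also have "\<dots> = G - {0}"
      using c_pos by (force simp: G_def grid_def)
    also have "\<dots> = e ` {1..m}"
    proof -
      have "{0..m} = insert 0 {1..m}" by auto
      moreover have "0 \<notin> e ` {1..m}"
      proof
        assume "0 \<in> e ` {1..m}"
        then obtain k where "k \<in> {1..m}" "e k = 0"
          by (metis imageE)
        then show False
          using less[of 0 k] e0 by simp
      qed
      ultimately show ?thesis
        unfolding e(2) by (simp add: e0)
    qed
    finally have X: "completion_time p S ` J = e ` {1..m}" .
    have piece: "S j u = S j (e (i - 1))" if "i \<in> {1..m}" "u \<in> {e (i - 1)..<e i}" for i u j
    proof -
      have im: "i - 1 \<le> m" "i - 1 < i" "i \<le> m" using that(1) by auto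
      have "same_piece G (e (i - 1)) u"
      proof (rule same_pieceI[OF G(1-3)])
        show "0 \<le> e (i - 1)"
          using G(3)[OF inG[OF im(1)]] .
        show "prev_point G (e (i - 1)) \<le> u"
          using prev_point_eq[OF G(1-3) inG[OF im(1)]] that(2) by simp
        fix g
        assume g: "g \<in> G" "e (i - 1) < g"
        then obtain k where k: "k \<le> m" "g = e k"
          using e(2) by auto
        have "i \<le> k"
        proof (rule ccontr)
          assume "\<not> i \<le> k"
          then have "k = i - 1 \<or> k < i - 1" by linarith
          then have "e k \<le> e (i - 1)"
            using less[OF _ im(1), of k] by (metis less_eq_real_def)
          then show False using g k by simp
        qed
        then have "e i \<le> g"
          using less[of i k] k by (cases "i = k") auto
        then show "u < g" using that(2) by simp
      qed
      then show ?thesis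
        unfolding S_def by (rule same_piece_eq(4))
    qed
    then have const: "\<forall>j\<in>J. \<forall>i\<in>{1..m}. \<forall>u\<in>{e (i - 1)..<e i}. \<forall>v\<in>{e (i - 1)..<e i}. S j u = S j v"
    proof (intro ballI)
      fix j i u v
      assume i: "i \<in> {1..m}" and uv: "u \<in> {e (i - 1)..<e i}" "v \<in> {e (i - 1)..<e i}"
      show "S j u = S j v"
        using piece[OF i uv(1), of j] piece[OF i uv(2), of j] by (rule trans[OF _ sym])
    qed
    show ?thesis
      unfolding normal_schedule_def simplicity_witnessed_by_def
      by (rule exI[of _ m], rule exI[of _ e]) (intro conjI e0 e(1) X const)
  qed
  ultimately have "S \<in> feasible_normal_schedules \<alpha> \<beta> J p"
    using sched feas by (simp add: feasible_normal_schedules_def)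
  then show ?thesis
    using compl by blast
qed

section \<open>Optimal plans\<close>

lemma convergent_subsequence_of_finite_family:
  fixes f :: "nat \<Rightarrow> 'a \<Rightarrow> real"
  assumes "finite A" "\<And>n a. a \<in> A \<Longrightarrow> \<bar>f n a\<bar> \<le> B a"
  shows "\<exists>r l. strict_mono (r :: nat \<Rightarrow> nat) \<and> (\<forall>a\<in>A. (\<lambda>n. f (r n) a) \<longlonglongrightarrow> l a)"
  using assms
proof (induction A)
  case empty
  then show ?case
    using strict_mono_id by blast
next
  case (insert b A)
  then obtain r l where r: "strict_mono (r :: nat \<Rightarrow> nat)" "\<forall>a\<in>A. (\<lambda>n. f (r n) a) \<longlonglongrightarrow> l a"
    by auto
  have "bounded (range (\<lambda>n. f (r n) b))"
    using insert.prems[of b] by (auto simp: bounded_iff)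
  then obtain x q where q: "strict_mono (q :: nat \<Rightarrow> nat)" "((\<lambda>n. f (r n) b) \<circ> q) \<longlonglongrightarrow> x"
    using bounded_imp_convergent_subsequence by blast
  have "strict_mono (r \<circ> q)"
    using r(1) q(1) by (rule strict_mono_o)
  moreover have "(\<lambda>n. f ((r \<circ> q) n) a) \<longlonglongrightarrow> (l(b := x)) a" if "a \<in> insert b A" for a
  proof (cases "a = b")
    case True
    then show ?thesis using q(2) by (simp add: comp_def)
  next
    case False
    then have "(\<lambda>n. f (r n) a) \<longlonglongrightarrow> l a" using r(2) that by blast
    then show ?thesis
      using LIMSEQ_subseq_LIMSEQ[OF _ q(1)] False by (fastforce simp: comp_def)
  qed
  ultimately show ?case by blast
qed

text \<open>
  All jobs proceed at constant rates and finish together, so late that neither the machine nor the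
  temperatures are a constraint.
\<close>

lemma plan_exists:
  assumes fin: "finite J" and rates: "\<alpha> < 0" "0 < \<beta>" and p: "\<And>j. j \<in> J \<Longrightarrow> 0 < p j"
  shows "\<exists>c W. plan \<alpha> \<beta> J p c W"
proof -
  define \<kappa> where "\<kappa> = (\<beta> - \<alpha>) / (- \<alpha>)"
  have \<kappa>: "\<kappa> > 0" "- \<alpha> * (\<kappa> * x) = (\<beta> - \<alpha>) * x" for x
  proof -
    show "\<kappa> > 0"
      unfolding \<kappa>_def using rates by (intro divide_pos_pos) auto
  qed (use rates in \<open>simp add: \<kappa>_def\<close>)
  define L where "L = (\<Sum>j\<in>J. p j) + (\<Sum>j\<in>J. \<kappa> * p j)"
  have heat_nonneg: "0 \<le> \<kappa> * p j" if "j \<in> J" for j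
    using \<kappa>(1) p[OF that] by simp
  have L: "L > 0" if "j \<in> J" for j
    unfolding L_def using fin that p by (intro add_pos_nonneg sum_pos sum_nonneg heat_nonneg) auto
  have work_le: "(\<Sum>j\<in>J. p j) \<le> L"
    unfolding L_def using sum_nonneg[OF heat_nonneg, of J "\<lambda>j. j"] by simp
  have heat_le: "(\<beta> - \<alpha>) * p j \<le> - \<alpha> * L" if "j \<in> J" for j
  proof -
    have "\<kappa> * p j \<le> (\<Sum>j\<in>J. \<kappa> * p j)"
      using fin that heat_nonneg by (intro member_le_sum) auto
    also have "\<dots> \<le> L"
      unfolding L_def using sum_nonneg[OF less_imp_le[OF p], of J "\<lambda>j. j"] by simp
    finally have "- \<alpha> * (\<kappa> * p j) \<le> - \<alpha> * L"
      using rates by (intro mult_left_mono) auto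
    then show ?thesis
      unfolding \<kappa>(2) .
  qed
  have "plan \<alpha> \<beta> J p (\<lambda>_. L) (\<lambda>j t. if t = 0 then 0 else p j)"
    unfolding plan_def grid_def
  proof (intro conjI ballI impI)
    fix s t
    assume st: "s \<in> insert 0 ((\<lambda>_. L) ` J)" "t \<in> insert 0 ((\<lambda>_. L) ` J)" "s \<le> t"
    consider "s = t" | j where "j \<in> J" "s = 0" "t = L"
      using st L by fastforce
    note cases = this
    show "(\<Sum>j\<in>J. (if t = 0 then 0 else p j) - (if s = 0 then 0 else p j)) \<le> t - s"
      using cases
    proof cases
      case 2
      then show ?thesis using work_le L[of j] by simp
    qed simp
    fix k
    assume "k \<in> J"
    show "(if s = 0 then 0 else p k) \<le> (if t = 0 then 0 else p k)"
      using cases p[OF \<open>k \<in> J\<close>] by cases auto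
    show "(\<beta> - \<alpha>) * ((if t = 0 then 0 else p k) - (if s = 0 then 0 else p k)) \<le> 1 - \<alpha> * (t - s)"
      using cases
    proof cases
      case 2
      then show ?thesis using heat_le[OF \<open>k \<in> J\<close>] L[of j] by simp
    qed simp
  qed (use L in fastforce)+
  then show ?thesis by blast
qed

text \<open>
  A minimising sequence of plans has a subsequence along which all grid points and all amounts of
  work converge. For two grid points with different limits the order is eventually that of the limits, and
  the inequalities pass to the limit. If two grid points merge in the limit, so do the amounts of
  work, because work grows at most at unit speed, and the inequalities become trivial.
\<close>

lemma optimal_plan_exists:
  fixes J :: "'j set"
  assumes fin: "finite J" and rates: "\<alpha> < 0" "0 < \<beta>" and p: "\<And>j. j \<in> J \<Longrightarrow> 0 < p j"
  obtains c W where "plan \<alpha> \<beta> J p c W" "\<And>c' W'. plan \<alpha> \<beta> J p c' W' \<Longrightarrow> sum c J \<le> sum c' J"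
proof -
  define V where "V = {sum c J | c. \<exists>W. plan \<alpha> \<beta> J p c W}"
  define v where "v = Inf V"
  have c_nonneg: "0 \<le> c k" if "plan \<alpha> \<beta> J p c W" "k \<in> J" for c W k
    using that by (simp add: plan_def)
  have "V \<noteq> {}"
    using plan_exists[OF fin rates p] by (auto simp: V_def)
  have "bdd_below V"
    unfolding V_def using c_nonneg by (intro bdd_belowI[of _ 0]) (auto intro!: sum_nonneg)
  then have v_le: "v \<le> sum c J" if "plan \<alpha> \<beta> J p c W" for c W
    unfolding v_def using that by (intro cInf_lower) (auto simp: V_def)
  have "\<exists>c W. plan \<alpha> \<beta> J p c W \<and> sum c J < v + 1 / real (Suc n)" for n
  proof -
    have "Inf V < v + 1 / real (Suc n)" by (simp add: v_def)
    then show ?thesis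
      using cInf_lessD[OF \<open>V \<noteq> {}\<close>] unfolding V_def by blast
  qed
  then obtain c W where P: "\<And>n. plan \<alpha> \<beta> J p (c n) (W n)" and
    c_lt: "\<And>n. sum (c n) J < v + 1 / real (Suc n)"
    by metis
  \<comment> \<open>Grid points are named by \<open>None\<close> (time \<open>0\<close>) and \<open>Some k\<close> (completion of \<open>k\<close>), so that the
    limit can be taken although points may merge.\<close>
  define I where "I = insert None (Some ` J)"
  define C where "C n i = (case i of None \<Rightarrow> 0 | Some k \<Rightarrow> c n k)" for n i
  define w where "w n j i = W n j (C n i)" for n j i
  have grid: "grid J (c n) = C n ` I" for n
    by (simp add: grid_def I_def C_def image_image)
  have C_grid: "C n i \<in> grid J (c n)" if "i \<in> I" for n i
    using that grid by blast
  have C_nonneg: "0 \<le> C n i" if "i \<in> I" for n i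
    using that c_nonneg[OF P] by (auto simp: I_def C_def)
  have C_le: "C n i \<le> v + 1" if "i \<in> I" for n i
  proof -
    have "C n i \<le> sum (c n) J"
    proof (cases i)
      case None
      then show ?thesis
        using sum_nonneg[OF c_nonneg[OF P[of n]], of J "\<lambda>k. k"] by (simp add: C_def)
    next
      case (Some k)
      then have "k \<in> J" using that by (auto simp: I_def)
      then show ?thesis
        using member_le_sum[of k J "c n"] c_nonneg[OF P[of n]] fin Some by (simp add: C_def)
    qed
    also have "\<dots> \<le> v + 1"
    proof -
      have "1 / real (Suc n) \<le> 1" by simp
      then show ?thesis using c_lt[of n] by linarith
    qed
    finally show ?thesis .
  qed
  have w_start: "w n j None = 0" if "j \<in> J" for n j
    using P[of n] that by (simp add: plan_def w_def C_def)
  have w_stop: "w n j i = p j" if "j \<in> J" "i \<in> I" "C n (Some j) \<le> C n i" for n j i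
    using P[of n] that(1,3) C_grid[OF that(2), of n] by (simp add: plan_def w_def C_def)
  have w_step: "w n j i \<le> w n j k \<and> w n j k - w n j i \<le> C n k - C n i
      \<and> (\<beta> - \<alpha>) * (w n j k - w n j i) \<le> 1 - \<alpha> * (C n k - C n i)"
    if "j \<in> J" "i \<in> I" "k \<in> I" "C n i \<le> C n k" for n j i k
  proof -
    note grid = C_grid[OF that(2), of n] C_grid[OF that(3), of n]
    have "(\<beta> - \<alpha>) * (W n j (C n k) - W n j (C n i)) \<le> 1 - \<alpha> * (C n k - C n i)"
      using P[of n] grid that(1,4) unfolding plan_def by blast
    then show ?thesis
      using plan_increment[OF fin P[of n] that(1) grid that(4)] by (simp add: w_def)
  qed
  have w_total: "(\<Sum>j\<in>J. w n j k - w n j i) \<le> C n k - C n i"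
    if "i \<in> I" "k \<in> I" "C n i \<le> C n k" for n i k
    using P[of n] C_grid[OF that(1), of n] C_grid[OF that(2), of n] that(3)
    unfolding plan_def w_def by blast
  define f where "f n = case_sum (C n) (\<lambda>(j, i). w n j i)" for n
  define bnd where "bnd = case_sum (\<lambda>_ :: 'j option. v + 1) (\<lambda>(j, i :: 'j option). p j)"
  have "\<bar>f n a\<bar> \<le> bnd a" if "a \<in> I <+> (J \<times> I)" for n a
  proof -
    have "0 \<le> w n j i \<and> w n j i \<le> p j" if "j \<in> J" "i \<in> I" for j i
    proof -
      have "None \<in> I" by (simp add: I_def)
      moreover have "C n None \<le> C n i"
        using C_nonneg[OF that(2)] by (simp add: C_def)
      ultimately have "w n j None \<le> w n j i"
        using w_step that by blast
      then show ?thesis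
        using w_start[OF that(1)] plan_work_le[OF fin P[of n] that(1) C_grid[OF that(2)]]
        by (simp add: w_def)
    qed
    then show ?thesis
      using that C_nonneg C_le by (auto simp: f_def bnd_def)
  qed
  moreover have "finite (I <+> (J \<times> I))"
    using fin by (auto simp: I_def)
  ultimately obtain r l where r: "strict_mono (r :: nat \<Rightarrow> nat)"
      and lim: "\<forall>a\<in>I <+> (J \<times> I). (\<lambda>n. f (r n) a) \<longlonglongrightarrow> l a"
    using convergent_subsequence_of_finite_family[of "I <+> (J \<times> I)" f bnd] by blast
  define D where "D i = l (Inl i)" for i
  define u where "u j i = l (Inr (j, i))" for j i
  have C_lim: "(\<lambda>n. C (r n) i) \<longlonglongrightarrow> D i" if "i \<in> I" for i
    using bspec[OF lim InlI[OF that]] by (simp add: f_def D_def)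
  have w_lim: "(\<lambda>n. w (r n) j i) \<longlonglongrightarrow> u j i" if "j \<in> J" "i \<in> I" for j i
    using bspec[OF lim InrI, of "(j, i)"] that by (simp add: f_def u_def)
  have None: "None \<in> I" and Some: "\<And>k. k \<in> J \<Longrightarrow> Some k \<in> I"
    by (auto simp: I_def)
  have D0: "D None = 0"
    using LIMSEQ_unique[OF C_lim[OF None]] by (simp add: C_def)
  have u0: "u j None = 0" if "j \<in> J" for j
    using LIMSEQ_unique[OF w_lim[OF that None]] w_start[OF that] by simp
  have D_nonneg: "0 \<le> D i" if "i \<in> I" for i
    using C_nonneg[OF that] by (intro LIMSEQ_le_const[OF C_lim[OF that]]) auto
  have u_lip: "\<bar>u j k - u j i\<bar> \<le> \<bar>D k - D i\<bar>" if "j \<in> J" "i \<in> I" "k \<in> I" for j i k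
  proof (rule LIMSEQ_le)
    show "(\<lambda>n. \<bar>w (r n) j k - w (r n) j i\<bar>) \<longlonglongrightarrow> \<bar>u j k - u j i\<bar>"
      using that by (intro tendsto_intros w_lim)
    show "(\<lambda>n. \<bar>C (r n) k - C (r n) i\<bar>) \<longlonglongrightarrow> \<bar>D k - D i\<bar>"
      using that by (intro tendsto_intros C_lim)
    have "\<bar>w n j k - w n j i\<bar> \<le> \<bar>C n k - C n i\<bar>" for n
      using w_step[of j i k n] w_step[of j k i n] that by (cases "C n i \<le> C n k") auto
    then show "\<exists>N. \<forall>n\<ge>N. \<bar>w (r n) j k - w (r n) j i\<bar> \<le> \<bar>C (r n) k - C (r n) i\<bar>"
      by blast
  qed
  have ev: "\<forall>\<^sub>F n in sequentially. C (r n) i \<le> C (r n) k" if "i \<in> I" "k \<in> I" "D i < D k" for i k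
  proof -
    have "(\<lambda>n. C (r n) k - C (r n) i) \<longlonglongrightarrow> D k - D i"
      using that by (intro tendsto_intros C_lim)
    then have "\<forall>\<^sub>F n in sequentially. 0 < C (r n) k - C (r n) i"
      using that by (intro order_tendstoD) auto
    then show ?thesis by (rule eventually_mono) simp
  qed
  have u_step: "u j i \<le> u j k \<and> (\<beta> - \<alpha>) * (u j k - u j i) \<le> 1 - \<alpha> * (D k - D i)"
    if "j \<in> J" "i \<in> I" "k \<in> I" "D i \<le> D k" for j i k
  proof (cases "D i = D k")
    case True
    then have "u j i = u j k" using u_lip[OF that(1-3)] by simp
    then show ?thesis using True by simp
  next
    case False
    then have *: "\<forall>\<^sub>F n in sequentially. C (r n) i \<le> C (r n) k"
      using ev that by simp
    have "u j i \<le> u j k"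
    proof (rule tendsto_le[OF _ w_lim w_lim])
      show "\<forall>\<^sub>F n in sequentially. w (r n) j i \<le> w (r n) j k"
        using * by (rule eventually_mono) (use w_step that in blast)
    qed (use that in auto)
    moreover have "(\<beta> - \<alpha>) * (u j k - u j i) \<le> 1 - \<alpha> * (D k - D i)"
    proof (rule tendsto_le)
      show "(\<lambda>n. (\<beta> - \<alpha>) * (w (r n) j k - w (r n) j i)) \<longlonglongrightarrow> (\<beta> - \<alpha>) * (u j k - u j i)"
        using that by (intro tendsto_intros w_lim)
      show "(\<lambda>n. 1 - \<alpha> * (C (r n) k - C (r n) i)) \<longlonglongrightarrow> 1 - \<alpha> * (D k - D i)"
        using that by (intro tendsto_intros C_lim)
      show "\<forall>\<^sub>F n in sequentially. (\<beta> - \<alpha>) * (w (r n) j k - w (r n) j i) \<le> 1 - \<alpha> * (C (r n) k - C (r n) i)"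
        using * by (rule eventually_mono) (use w_step that in blast)
    qed simp
    ultimately show ?thesis ..
  qed
  have u_total: "(\<Sum>j\<in>J. u j k - u j i) \<le> D k - D i" if "i \<in> I" "k \<in> I" "D i \<le> D k" for i k
  proof (cases "D i = D k")
    case True
    then have "u j k - u j i = 0" if "j \<in> J" for j
      using u_lip[OF that \<open>i \<in> I\<close> \<open>k \<in> I\<close>] by simp
    then show ?thesis using True by simp
  next
    case False
    then have *: "\<forall>\<^sub>F n in sequentially. C (r n) i \<le> C (r n) k"
      using ev that by simp
    show ?thesis
    proof (rule tendsto_le)
      show "(\<lambda>n. \<Sum>j\<in>J. w (r n) j k - w (r n) j i) \<longlonglongrightarrow> (\<Sum>j\<in>J. u j k - u j i)"
        using that by (intro tendsto_intros w_lim)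
      show "(\<lambda>n. C (r n) k - C (r n) i) \<longlonglongrightarrow> D k - D i"
        using that by (intro tendsto_intros C_lim)
      show "\<forall>\<^sub>F n in sequentially. (\<Sum>j\<in>J. w (r n) j k - w (r n) j i) \<le> C (r n) k - C (r n) i"
        using * by (rule eventually_mono) (use w_total that in blast)
    qed simp
  qed
  have u_stop: "u j i = p j" if "j \<in> J" "i \<in> I" "D (Some j) \<le> D i" for j i
  proof -
    have "u j (Some j) = p j"
      using LIMSEQ_unique[OF w_lim[OF that(1) Some[OF that(1)]]] w_stop[OF that(1) Some[OF that(1)] order_refl] by simp
    show ?thesis
    proof (cases "D (Some j) = D i")
      case True
      then show ?thesis
        using u_lip[OF that(1) Some[OF that(1)] that(2)] \<open>u j (Some j) = p j\<close> by simp
    next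
      case False
      then have "\<forall>\<^sub>F n in sequentially. C (r n) (Some j) \<le> C (r n) i"
        using ev[OF Some[OF that(1)] that(2)] that(3) by simp
      then have "\<forall>\<^sub>F n in sequentially. w (r n) j i = p j"
        by (rule eventually_mono) (use w_stop that in blast)
      then have "(\<lambda>n. w (r n) j i) \<longlonglongrightarrow> p j"
        by (rule tendsto_eventually)
      then show ?thesis
        using LIMSEQ_unique w_lim[OF that(1,2)] by blast
    qed
  qed
  define U where "U j t = u j (SOME i. i \<in> I \<and> D i = t)" for j t
  have U: "U j (D i) = u j i" if "j \<in> J" "i \<in> I" for j i
  proof -
    have "(SOME k. k \<in> I \<and> D k = D i) \<in> I \<and> D (SOME k. k \<in> I \<and> D k = D i) = D i"
      using that(2) by (intro someI[of "\<lambda>k. k \<in> I \<and> D k = D i" i]) simp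
    then show ?thesis
      using u_lip[OF that(1,2), of "SOME k. k \<in> I \<and> D k = D i"] by (simp add: U_def)
  qed
  have grid': "grid J (\<lambda>k. D (Some k)) = D ` I"
    using D0 by (simp add: grid_def I_def image_image)
  have "plan \<alpha> \<beta> J p (\<lambda>k. D (Some k)) U"
    unfolding plan_def grid'
  proof (intro conjI ballI impI)
    fix j
    assume j: "j \<in> J"
    show "0 \<le> D (Some j)" using D_nonneg[OF Some[OF j]] .
    show "U j 0 = 0" using U[OF j None] D0 u0[OF j] by simp
    fix g
    assume "g \<in> D ` I" "D (Some j) \<le> g"
    then show "U j g = p j" using u_stop[OF j] U[OF j] by auto
  next
    fix s t
    assume st: "s \<in> D ` I" "t \<in> D ` I" "s \<le> t"
    show "(\<Sum>j\<in>J. U j t - U j s) \<le> t - s"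
      using st u_total U by auto
    fix j
    assume "j \<in> J"
    then show "U j s \<le> U j t" "(\<beta> - \<alpha>) * (U j t - U j s) \<le> 1 - \<alpha> * (t - s)"
      using st u_step U by auto
  qed
  moreover have "(\<Sum>k\<in>J. D (Some k)) \<le> v"
  proof (rule LIMSEQ_le)
    show "(\<lambda>n. \<Sum>k\<in>J. C (r n) (Some k)) \<longlonglongrightarrow> (\<Sum>k\<in>J. D (Some k))"
      by (intro tendsto_intros C_lim Some)
    show "(\<lambda>n. v + 1 / real (Suc (r n))) \<longlonglongrightarrow> v"
      using tendsto_add[OF tendsto_const[of v] LIMSEQ_subseq_LIMSEQ[OF LIMSEQ_inverse_real_of_nat r]]
      by (simp add: comp_def inverse_eq_divide)
    show "\<exists>N. \<forall>n\<ge>N. (\<Sum>k\<in>J. C (r n) (Some k)) \<le> v + 1 / real (Suc (r n))"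
      using c_lt by (auto simp: C_def intro: less_imp_le)
  qed
  ultimately show thesis
    using that v_le by (meson order_trans)
qed

text \<open>
  By the exchange lemma, removing an inversion gives another permutation of the same completion
  times with a larger sum of products \<open>p j * c j\<close>, so a permutation that maximises this sum has none.
\<close>

lemma sorted_optimal_plan_exists:
  fixes J :: "'j set"
  assumes fin: "finite J" and rates: "\<alpha> < 0" "0 < \<beta>" and p: "\<And>j. j \<in> J \<Longrightarrow> 0 < p j"
  obtains c W where "plan \<alpha> \<beta> J p c W" "\<And>c' W'. plan \<alpha> \<beta> J p c' W' \<Longrightarrow> sum c J \<le> sum c' J"
    "\<And>i j. \<lbrakk>i \<in> J; j \<in> J; p i < p j\<rbrakk> \<Longrightarrow> c i \<le> c j"
proof -
  obtain c W where P: "plan \<alpha> \<beta> J p c W"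
    and opt: "\<And>c' W'. plan \<alpha> \<beta> J p c' W' \<Longrightarrow> sum c J \<le> sum c' J"
    using optimal_plan_exists[where p = p, OF fin rates p] by metis
  define Q where "Q = {\<pi>. \<pi> permutes J \<and> (\<exists>W. plan \<alpha> \<beta> J p (c \<circ> \<pi>) W)}"
  define \<phi> where "\<phi> \<pi> = (\<Sum>j\<in>J. p j * c (\<pi> j))" for \<pi> :: "'j \<Rightarrow> 'j"
  have "finite Q"
    using finite_permutations[OF fin] by (rule finite_subset[rotated]) (auto simp: Q_def)
  moreover have "id \<in> Q"
    using P by (auto simp: Q_def permutes_id)
  ultimately have "Max (\<phi> ` Q) \<in> \<phi> ` Q"
    by (intro Max_in) auto
  then obtain \<pi> where \<pi>: "\<pi> \<in> Q" "Max (\<phi> ` Q) = \<phi> \<pi>"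
    by blast
  have max: "\<phi> \<sigma> \<le> \<phi> \<pi>" if "\<sigma> \<in> Q" for \<sigma>
    using that \<open>finite Q\<close> by (simp flip: \<pi>(2))
  have perm: "\<pi> permutes J" using \<pi>(1) by (simp add: Q_def)
  obtain W' where P': "plan \<alpha> \<beta> J p (c \<circ> \<pi>) W'"
    using \<pi>(1) by (auto simp: Q_def)
  have "sum (c \<circ> \<pi>) J = sum c J"
    using sum.permute[OF perm, of c] by simp
  moreover have "c (\<pi> i) \<le> c (\<pi> j)" if ij: "i \<in> J" "j \<in> J" "p i < p j" for i j
  proof (rule ccontr)
    assume "\<not> c (\<pi> i) \<le> c (\<pi> j)"
    then have inv: "c (\<pi> j) < c (\<pi> i)" by simp
    have "i \<noteq> j" using ij by auto
    define \<sigma> where "\<sigma> = \<pi> \<circ> Transposition.transpose i j"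
    have "\<sigma> permutes J"
      unfolding \<sigma>_def using permutes_swap_id[OF ij(1,2)] perm by (rule permutes_compose)
    moreover have "c \<circ> \<sigma> = (c \<circ> \<pi>)(i := (c \<circ> \<pi>) j, j := (c \<circ> \<pi>) i)"
      by (auto simp: \<sigma>_def fun_eq_iff Transposition.transpose_def)
    moreover have "\<exists>W. plan \<alpha> \<beta> J p ((c \<circ> \<pi>)(i := (c \<circ> \<pi>) j, j := (c \<circ> \<pi>) i)) W"
      using plan_swap[OF fin _ P' ij] rates inv by simp
    ultimately have "\<sigma> \<in> Q"
      by (simp add: Q_def)
    have split: "sum F J = F i + F j + sum F (J - {i, j})" for F :: "'j \<Rightarrow> real"
      using fin ij \<open>i \<noteq> j\<close> by (simp add: sum.remove[of J i] sum.remove[of "J - {i}" j] insert_commute flip: Diff_insert)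
    have "(\<Sum>k\<in>J - {i, j}. p k * c (\<sigma> k)) = (\<Sum>k\<in>J - {i, j}. p k * c (\<pi> k))"
      by (intro sum.cong) (auto simp: \<sigma>_def Transposition.transpose_def)
    then have "\<phi> \<sigma> - \<phi> \<pi> = (p j - p i) * (c (\<pi> i) - c (\<pi> j))"
      unfolding \<phi>_def split by (simp add: \<sigma>_def algebra_simps)
    also have "\<dots> > 0"
      using ij inv by simp
    finally show False
      using max[OF \<open>\<sigma> \<in> Q\<close>] by simp
  qed
  ultimately show thesis
    using that[OF P'] opt by simp
qed

theorem theorem2:
  fixes J :: "'j set" and p :: "'j \<Rightarrow> real" and \<alpha> \<beta> :: real
  assumes "finite J" and "J \<noteq> {}"
    and "\<And>j. j \<in> J \<Longrightarrow> p j \<in> \<rat>" and "\<And>j. j \<in> J \<Longrightarrow> p j > 0"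
    and "\<alpha> \<in> \<rat>" and "\<alpha> < 0"
    and "\<beta> \<in> \<rat>" and "\<beta> > 0"
  shows "\<exists>S \<in> feasible_normal_schedules \<alpha> \<beta> J p.
    (\<Sum>j\<in>J. completion_time p S j) =
      Inf {\<Sum>j\<in>J. completion_time p S' j | S'. S' \<in> feasible_normal_schedules \<alpha> \<beta> J p} \<and>
    (\<forall>i\<in>J. \<forall>j\<in>J. p i < p j \<longrightarrow> completion_time p S i \<le> completion_time p S j)"
proof -
  note fin = \<open>finite J\<close> and p = assms(4) and rates = \<open>\<alpha> < 0\<close> \<open>0 < \<beta>\<close>
  obtain c W where P: "plan \<alpha> \<beta> J p c W"
    and opt: "\<And>c' W'. plan \<alpha> \<beta> J p c' W' \<Longrightarrow> sum c J \<le> sum c' J"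
    and sorted: "\<And>i j. \<lbrakk>i \<in> J; j \<in> J; p i < p j\<rbrakk> \<Longrightarrow> c i \<le> c j"
    using sorted_optimal_plan_exists[where p = p, OF fin rates p] by metis
  obtain c' where P': "plan \<alpha> \<beta> J p c' W" and le: "\<And>j. j \<in> J \<Longrightarrow> c' j \<le> c j"
    and tight: "\<And>j g. \<lbrakk>j \<in> J; g \<in> grid J c'; g < c' j\<rbrakk> \<Longrightarrow> W j g < p j"
    using tight_plan[OF fin P] by metis
  \<comment> \<open>A pointwise smaller plan cannot beat an optimal one, so nothing was gained by tightening.\<close>
  have eq: "c' j = c j" if "j \<in> J" for j
    using sum_mono_inv[of c' J c j] sum_mono[of J c' c] le opt[OF P'] fin that by force
  obtain S where S: "S \<in> feasible_normal_schedules \<alpha> \<beta> J p" "\<And>j. j \<in> J \<Longrightarrow> completion_time p S j = c' j"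
    using schedule_of_tight_plan[OF fin rates p P' tight] by blast
  have C: "completion_time p S j = c j" if "j \<in> J" for j
    using S(2) eq that by simp
  show ?thesis
  proof (rule bexI[OF _ S(1)], intro conjI ballI impI)
    show "(\<Sum>j\<in>J. completion_time p S j) =
      Inf {\<Sum>j\<in>J. completion_time p S' j | S'. S' \<in> feasible_normal_schedules \<alpha> \<beta> J p}"
    proof (rule cInf_eq_minimum[symmetric])
      fix x
      assume "x \<in> {\<Sum>j\<in>J. completion_time p S' j | S'. S' \<in> feasible_normal_schedules \<alpha> \<beta> J p}"
      then obtain S' where S': "schedule J S'" "feasible \<alpha> \<beta> J S'" "all_completed J p S'"
        and x: "x = (\<Sum>j\<in>J. completion_time p S' j)"
        by (auto simp: feasible_normal_schedules_def)
      have "(\<Sum>j\<in>J. completion_time p S j) = sum c J"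
        using C by simp
      also have "\<dots> \<le> x"
        unfolding x using rates by (intro opt[OF plan_of_schedule[OF fin _ p S']]) auto
      finally show "(\<Sum>j\<in>J. completion_time p S j) \<le> x" .
    qed (use S(1) in blast)
  next
    fix i j
    assume "i \<in> J" "j \<in> J" "p i < p j"
    then show "completion_time p S i \<le> completion_time p S j"
      using sorted C by simp
  qed
qed

end
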